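(* Let $\theta$ be an inner function, let $\theta_0$ be its $0$-th Fourier coefficient, and let $\phi\in L^\infty$. Then the dual truncated Hankel operator $\mathcal{H}_\phi^\theta$ satisfies $$\mathcal{H}_\phi^\theta-U_\theta\mathcal{H}_\phi^\theta U_\theta=\theta\otimes\left(Q_\theta J(\alpha_{\phi^*})-\langle Q_\theta J(\alpha_{\phi^*}),\bar z\rangle\bar z\right)+\left(Q_\theta J\left(\phi\bar z(1-\bar\theta_0\theta)\right)+\delta\theta\right)\otimes\bar z,$$ where $\alpha_\phi=\phi(\theta-\theta_0)$ (so $\alpha_{\phi^*}=\phi^*(\theta-\theta_0)$) and $\delta=\bar\theta_0\langle\phi\theta(\theta^*-\bar\theta_0),z\rangle$.
   Context: $\mathbb{T}$ is the unit circle with normalized Lebesgue measure, $L^2=L^2(\mathbb{T})$ with inner product $\langle\cdot,\cdot\rangle$ linear in the first entry, $L^\infty=L^\infty(\mathbb{T})$. $H^2\subset L^2$ is the Hardy space (functions whose negative Fourier coefficients vanish), $H_0^2=zH^2$, $\overline{H_0^2}=L^2\ominus H^2$. $P:L^2\to H^2$ is the orthogonal projection and $Q=I-P$ is the orthogonal projection onto $\overline{H_0^2}$. The flip $J$ on $L^2$ is $(Jf)(z)=f(\bar z)$, $z\in\mathbb{T}$. For an inner function $\theta$ (bounded analytic on the disk, unimodular a.e. on $\mathbb{T}$), $K_\theta=H^2\ominus\theta H^2$ and $K_\theta^\perp=L^2\ominus K_\theta=\overline{H_0^2}\oplus\theta H^2$; $Q_\theta=Q+\theta P\bar\theta$ is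 the orthogonal projection of $L^2$ onto $K_\theta^\perp$. For $\phi\in L^\infty$ the dual truncated Hankel operator is $\mathcal{H}_\phi^\theta:K_\theta^\perp\to K_\theta^\perp$, $\mathcal{H}_\phi^\theta(h)=Q_\theta J(\phi h)$. The compressed shift on $K_\theta^\perp$ is $U_\theta h=Q_\theta(zh)$. For $f,g$ in a Hilbert space, $f\otimes g$ is the operator $h\mapsto\langle h,g\rangle f$. For $\phi\in L^2$, $\phi^*(z)=\overline{\phi(\bar z)}$ on $\mathbb{T}$. *)

theory Defs
  imports "HOL-Analysis.Analysis"
begin

text \<open>
  Elements of \<open>L\<^sup>2\<close> and \<open>L\<^sup>\<infinity>\<close> of the unit circle are represented by Borel functions
  \<open>complex \<Rightarrow> complex\<close>, of which only the values on the circle matter. The classical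
  elements are the classes of such functions modulo equality almost everywhere, so
  equations between elements are stated with \<open>AE z in circle\<close>.
\<close>

definition circle :: "complex measure" where
  "circle = distr (uniform_measure lborel {0..2 * pi}) (restrict_space borel (sphere 0 1)) cis"

definition L2 :: "(complex \<Rightarrow> complex) set" where
  "L2 = {f \<in> borel_measurable circle. integrable circle (\<lambda>z. (cmod (f z))\<^sup>2)}"

definition Linf :: "(complex \<Rightarrow> complex) set" where
  "Linf = {f \<in> borel_measurable circle. \<exists>C. AE z in circle. cmod (f z) \<le> C}"

definition ip :: "(complex \<Rightarrow> complex) \<Rightarrow> (complex \<Rightarrow> complex) \<Rightarrow> complex" where
  "ip f g = (\<integral>z. f z * cnj (g z) \<partial>circle)"

definition fourier_coeff :: "(complex \<Rightarrow> complex) \<Rightarrow> int \<Rightarrow> complex" where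
  "fourier_coeff f n = ip f (\<lambda>z. z powi n)"

definition H2 :: "(complex \<Rightarrow> complex) set" where
  "H2 = {f \<in> L2. \<forall>n<0. fourier_coeff f n = 0}"

definition ominus ::
    "(complex \<Rightarrow> complex) set \<Rightarrow> (complex \<Rightarrow> complex) set \<Rightarrow> (complex \<Rightarrow> complex) set"
    (infixl "\<ominus>" 65) where
  "M \<ominus> N = {f \<in> M. \<forall>g\<in>N. ip f g = 0}"

text \<open>
  The orthogonal projection is determined only almost everywhere; \<open>SOME\<close> picks a
  representative.
\<close>

definition orth_proj :: "(complex \<Rightarrow> complex) set \<Rightarrow> (complex \<Rightarrow> complex) \<Rightarrow> complex \<Rightarrow> complex" where
  "orth_proj M f = (SOME g. g \<in> M \<and> (\<lambda>z. f z - g z) \<in> L2 \<ominus> M)"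

definition P :: "(complex \<Rightarrow> complex) \<Rightarrow> complex \<Rightarrow> complex" where
  "P = orth_proj H2"

definition Q :: "(complex \<Rightarrow> complex) \<Rightarrow> complex \<Rightarrow> complex" where
  "Q f = (\<lambda>z. f z - P f z)"

definition flip :: "(complex \<Rightarrow> complex) \<Rightarrow> complex \<Rightarrow> complex" where
  "flip f = (\<lambda>z. f (cnj z))"

definition star :: "(complex \<Rightarrow> complex) \<Rightarrow> complex \<Rightarrow> complex" where
  "star f = (\<lambda>z. cnj (f (cnj z)))"

text \<open>
  A single function carries both the analytic function on the open disk and its
  boundary function on the circle, the latter being the radial limit of the former.
\<close>

definition inner_function :: "(complex \<Rightarrow> complex) \<Rightarrow> bool" where
  "inner_function \<theta> \<longleftrightarrow>
     \<theta> holomorphic_on ball 0 1 \<and> bounded (\<theta> ` ball 0 1) \<and>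
     \<theta> \<in> borel_measurable circle \<and>
     (AE z in circle. ((\<lambda>r. \<theta> (of_real r * z)) \<longlongrightarrow> \<theta> z) (at_left 1)) \<and>
     (AE z in circle. cmod (\<theta> z) = 1)"

definition mult_H2 :: "(complex \<Rightarrow> complex) \<Rightarrow> (complex \<Rightarrow> complex) set" where
  "mult_H2 \<theta> = {f \<in> L2. \<exists>g\<in>H2. AE z in circle. f z = \<theta> z * g z}"

definition K :: "(complex \<Rightarrow> complex) \<Rightarrow> (complex \<Rightarrow> complex) set" where
  "K \<theta> = H2 \<ominus> mult_H2 \<theta>"

definition K_perp :: "(complex \<Rightarrow> complex) \<Rightarrow> (complex \<Rightarrow> complex) set" where
  "K_perp \<theta> = L2 \<ominus> K \<theta>"

definition Q_theta :: "(complex \<Rightarrow> complex) \<Rightarrow> (complex \<Rightarrow> complex) \<Rightarrow> complex \<Rightarrow> complex" where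
  "Q_theta \<theta> f = (\<lambda>z. Q f z + \<theta> z * P (\<lambda>w. cnj (\<theta> w) * f w) z)"

text \<open>
  The two operators below act on \<open>K_perp \<theta>\<close>.
\<close>

definition dual_trunc_hankel ::
    "(complex \<Rightarrow> complex) \<Rightarrow> (complex \<Rightarrow> complex) \<Rightarrow> (complex \<Rightarrow> complex) \<Rightarrow> complex \<Rightarrow> complex" where
  "dual_trunc_hankel \<theta> \<phi> h = Q_theta \<theta> (flip (\<lambda>z. \<phi> z * h z))"

definition compressed_shift ::
    "(complex \<Rightarrow> complex) \<Rightarrow> (complex \<Rightarrow> complex) \<Rightarrow> complex \<Rightarrow> complex" where
  "compressed_shift \<theta> h = Q_theta \<theta> (\<lambda>z. z * h z)"

definition rank_one ::
    "(complex \<Rightarrow> complex) \<Rightarrow> (complex \<Rightarrow> complex) \<Rightarrow> (complex \<Rightarrow> complex) \<Rightarrow> complex \<Rightarrow> complex" where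
  "rank_one f g h = (\<lambda>z. ip h g * f z)"

definition alpha :: "(complex \<Rightarrow> complex) \<Rightarrow> (complex \<Rightarrow> complex) \<Rightarrow> complex \<Rightarrow> complex" where
  "alpha \<theta> \<phi> = (\<lambda>z. \<phi> z * (\<theta> z - fourier_coeff \<theta> 0))"

definition delta :: "(complex \<Rightarrow> complex) \<Rightarrow> (complex \<Rightarrow> complex) \<Rightarrow> complex" where
  "delta \<theta> \<phi> = (let \<theta>0 = fourier_coeff \<theta> 0 in
     cnj \<theta>0 * ip (\<lambda>z. \<phi> z * \<theta> z * (star \<theta> z - cnj \<theta>0)) (\<lambda>z. z))"

end

theory Submission
  imports Defs "HOL-Complex_Analysis.Cauchy_Integral_Formula"
begin

text \<open>
  Write \<open>J\<close> for the flip, \<open>U\<close> for the compressed shift, \<open>H\<close> for the dual truncated Hankel operator,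
  \<open>\<theta>0\<close> for \<open>\<theta>(0)\<close>, and \<open>c = \<langle>h, cnj z\<rangle>\<close>. The identity compares \<open>U\<close> with multiplication by \<open>z\<close>.
  It rests on \<open>J (z f) = cnj z J f\<close>: were \<open>U\<close> just multiplication by \<open>z\<close> and free to move past the
  projection, the two factors \<open>U\<close> in \<open>U H U\<close> would cancel. Each \<open>U\<close> makes an error of rank one.

  On the complement of the model space, \<open>U h = z h - c (1 - cnj \<theta>0 \<theta>)\<close>
  (\<open>compressed_shift_K_perp\<close>): only the frequency \<open>-1\<close> of \<open>h\<close> is pushed into the model space by
  multiplication by \<open>z\<close>, and \<open>1 - cnj \<theta>0 \<theta>\<close> is the projection of the constant 1 to that space.
  For arbitrary square integrable \<open>g\<close>,
  \<open>U (Q_theta g) = Q_theta (z g) - \<langle>g, cnj z (\<theta> - \<theta>0)\<rangle> \<theta>\<close> (\<open>compressed_shift_Q_theta\<close>), because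
  multiplication by \<open>z\<close> leads out of the model space only in the direction of \<open>\<theta>\<close>. With
  \<open>g = J (\<phi> U h) = cnj z J (\<phi> h) - c J (\<phi> (1 - cnj \<theta>0 \<theta>))\<close> the second formula gives
  \<open>H h - U H U h\<close> as the sum of \<open>c Q_theta J (\<phi> cnj z (1 - cnj \<theta>0 \<theta>))\<close> and a multiple of \<open>\<theta>\<close>,
  whose coefficient is evaluated by moving the flip through inner products
  (\<open>coefficient_of_theta\<close>).

  Both formulas need that \<open>Q_theta f\<close> is, almost everywhere, the only function in the complement
  of the model space that differs from \<open>f\<close> by a member of the model space (\<open>Q_theta_eqI\<close>). That in
  turn rests on two facts of analysis: the projection onto the Hardy space exists, by completeness
  of the space of square integrable functions (\<open>orth_proj_ominus\<close>), and multiplication by \<open>\<theta>\<close>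
  preserves the Hardy space (\<open>inner_mult_H2\<close>), by expansion of \<open>\<theta>\<close> in a power series on smaller
  circles and passage to the radial limit.
\<close>

section \<open>Normalized arc length on the circle\<close>

lemma space_circle [simp]: "space circle = sphere 0 1"
  by (simp add: circle_def space_restrict_space)

lemma sets_circle: "sets circle = sets (restrict_space borel (sphere 0 1))"
  by (simp add: circle_def)

lemma borel_measurable_circleI:
  "f \<in> borel_measurable borel \<Longrightarrow> f \<in> borel_measurable circle"
  by (subst measurable_cong_sets[OF sets_circle refl]) (rule measurable_restrict_space1)

lemma measurable_ident_circle [measurable]: "(\<lambda>z. z) \<in> borel_measurable circle"
  by (rule borel_measurable_circleI) simp

lemma measurable_cnj_borel [measurable]: "cnj \<in> borel_measurable borel"
  by (rule borel_measurable_continuous_onI[OF continuous_on_cnj[OF continuous_on_id]])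

lemma measurable_cis_circle:
  "cis \<in> measurable (uniform_measure lborel {0..2 * pi}) (restrict_space borel (sphere 0 1))"
proof (rule measurable_restrict_space2)
  show "cis \<in> borel_measurable (uniform_measure lborel {0..2 * pi})"
    using borel_measurable_continuous_onI[OF continuous_on_cis[OF continuous_on_id]]
    by (simp add: measurable_def)
qed auto

lemma emeasure_circle: "emeasure circle (sphere 0 1) = 1"
proof -
  have "emeasure circle (sphere 0 1)
    = emeasure (uniform_measure lborel {0..2*pi}) (cis -` sphere 0 1 \<inter> UNIV)"
    unfolding circle_def
    using measurable_cis_circle
    by (subst emeasure_distr) (auto simp: sets_restrict_space)
  also have "\<dots> = emeasure lborel {0..2*pi} / emeasure lborel {0..2*pi}"
    by (subst emeasure_uniform_measure) (auto simp: vimage_def)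
  also have "\<dots> = 1"
    by (simp add: ennreal_divide_self)
  finally show ?thesis .
qed

lemma finite_measure_circle: "finite_measure circle"
  by (rule finite_measureI) (simp add: emeasure_circle)

interpretation circle: finite_measure circle by (rule finite_measure_circle)

lemma measure_circle [simp]: "measure circle (sphere 0 1) = 1"
  using emeasure_circle by (simp add: measure_def)

lemma measurable_cnj_circle [measurable]: "cnj \<in> measurable circle circle"
proof -
  from borel_measurable_circleI[OF measurable_cnj_borel]
  have "cnj \<in> measurable circle (restrict_space borel (sphere 0 1))"
    by (rule measurable_restrict_space2[rotated]) simp
  then show ?thesis
    by (subst measurable_cong_sets[OF refl sets_circle])
qed

text \<open>
  Conjugation corresponds to the reflection \<open>t \<mapsto> 2\<pi> - t\<close> of the parameter interval, and
  Lebesgue measure is invariant under reflections and translations.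
\<close>

lemma distr_cnj_circle: "distr circle circle cnj = circle"
proof (rule measure_eqI)
  fix A assume "A \<in> sets (distr circle circle cnj)"
  then have A: "A \<in> sets circle" by simp
  define B where "B = cis -` A"
  have A': "A \<in> sets (restrict_space borel (sphere 0 1))" using A sets_circle by simp
  then have "A \<in> sets borel"
    by (subst (asm) sets_restrict_space_iff) auto
  then have B: "B \<in> sets borel" unfolding B_def
    using measurable_sets[OF borel_measurable_continuous_onI[OF continuous_on_cis[OF continuous_on_id]], of A]
    by simp
  have em: "emeasure circle C = emeasure lborel ({0..2*pi} \<inter> cis -` C) / emeasure lborel {0..2*pi}"
    if "C \<in> sets circle" "cis -` C \<in> sets borel" for C
    unfolding circle_def using measurable_cis_circle that
    by (subst emeasure_distr) (auto simp: sets_circle)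
  let ?r = "\<lambda>t. 2 * pi + (-1) * t"
  have r: "cnj (cis t) = cis (?r t)" for t
    by (simp add: complex_eq_iff cos_diff sin_diff)
  have Ac: "cnj -` A \<inter> sphere 0 1 \<in> sets circle"
    using measurable_sets[OF measurable_cnj_circle A] by simp
  have eq: "cis -` (cnj -` A \<inter> sphere 0 1) = ?r -` B"
    by (auto simp: B_def r)
  have r_meas: "?r \<in> borel_measurable borel" by measurable
  then have rB: "?r -` B \<in> sets borel" using measurable_sets[OF r_meas B] by simp
  have lb: "lborel = distr lborel borel ?r"
    using lborel_real_affine[of "-1" "2*pi"] by (simp add: density_1)
  have "emeasure lborel ({0..2*pi} \<inter> B) = emeasure (distr lborel borel ?r) ({0..2*pi} \<inter> B)"
    using lb by simp
  also have "\<dots> = emeasure lborel (?r -` ({0..2*pi} \<inter> B))"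
    using B by (subst emeasure_distr) auto
  also have "?r -` ({0..2*pi} \<inter> B) = {0..2*pi} \<inter> ?r -` B"
    by auto
  finally have "emeasure lborel ({0..2*pi} \<inter> B) = emeasure lborel ({0..2*pi} \<inter> ?r -` B)" .
  then have "emeasure circle (cnj -` A \<inter> sphere 0 1) = emeasure circle A"
    using em[OF A] em[OF Ac] B rB unfolding eq B_def[symmetric] by simp
  then show "emeasure (distr circle circle cnj) A = emeasure circle A"
    using A by (subst emeasure_distr) (auto simp: measurable_cnj_circle)
qed simp

lemma integral_circle_cnj:
  fixes f :: "complex \<Rightarrow> 'a::{banach, second_countable_topology}"
  assumes "f \<in> borel_measurable circle"
  shows "(\<integral>z. f (cnj z) \<partial>circle) = (\<integral>z. f z \<partial>circle)"
  using integral_distr[OF measurable_cnj_circle assms] by (simp add: distr_cnj_circle)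

lemma integrable_circle_cnj:
  fixes f :: "complex \<Rightarrow> 'a::{banach, second_countable_topology}"
  assumes "integrable circle f"
  shows "integrable circle (\<lambda>z. f (cnj z))"
  using integrable_distr[OF measurable_cnj_circle, of f] assms by (simp add: distr_cnj_circle)

lemma AE_circle_cnj:
  assumes "AE z in circle. R z"
  shows "AE z in circle. R (cnj z)"
  using AE_distrD[OF measurable_cnj_circle, of R] assms unfolding distr_cnj_circle by simp

lemma AE_circle_sphere: "AE z in circle. cmod z = 1"
  using AE_space[of circle] by eventually_elim simp

lemma integral_circle_power:
  assumes "n > 0"
  shows "(\<integral>z. z ^ n \<partial>circle) = 0"
proof -
  \<comment> \<open>\<open>?F\<close> is a primitive of \<open>e\<^sup>i\<^sup>n\<^sup>t\<close> with period \<open>2\<pi>\<close>.\<close>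
  let ?F = "\<lambda>t. cis (real n * t) / (\<i> * of_nat n)"
  have "(\<integral>t. indicator {0..2*pi} t *\<^sub>R cis (real n * t) \<partial>lborel) = ?F (2*pi) - ?F 0"
  proof (rule integral_FTC_atLeastAtMost)
    show "(?F has_vector_derivative cis (real n * t)) (at t within {0..2*pi})" for t
    proof -
      have "((\<lambda>w. exp (\<i> * of_nat n * w) / (\<i> * of_nat n)) has_field_derivative
          exp (\<i> * of_nat n * of_real t)) (at (of_real t))"
        using assms by (auto intro!: derivative_eq_intros)
      from has_vector_derivative_real_field[OF this] show ?thesis
        by (simp add: cis_conv_exp mult_ac)
    qed
  qed (auto intro!: continuous_intros)
  also have "\<dots> = 0"
  proof -
    have "cis (real n * (2*pi)) = 1"
      using cis_multiple_2pi[of "real n"] by (simp add: mult_ac)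
    then show ?thesis by simp
  qed
  finally have 0: "(\<integral>t. indicator {0..2*pi} t *\<^sub>R cis (real n * t) \<partial>lborel) = 0" .
  have "(\<integral>z. z ^ n \<partial>circle) = (\<integral>t. cis t ^ n \<partial>uniform_measure lborel {0..2 * pi})"
    unfolding circle_def using measurable_cis_circle
    by (subst integral_distr) (auto intro!: measurable_restrict_space1)
  also have "\<dots> = (\<integral>t. (indicator {0..2*pi} t / (2*pi)) *\<^sub>R cis t ^ n \<partial>lborel)"
  proof -
    have "uniform_measure lborel {0..2*pi}
        = density lborel (\<lambda>t. ennreal (indicator {0..2*pi} t / (2*pi)))"
      unfolding uniform_measure_def
      by (intro arg_cong2[where f=density] refl ext)
         (auto simp: indicator_def divide_ennreal[of 1 "2*pi", simplified])
    then show ?thesis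
      by (simp add: integral_density borel_measurable_continuous_onI continuous_intros)
  qed
  also have "\<dots> = (\<integral>t. (1 / (2*pi)) *\<^sub>R (indicator {0..2*pi} t *\<^sub>R cis (real n * t)) \<partial>lborel)"
    by (simp add: Complex.DeMoivre mult_ac)
  also have "\<dots> = 0"
    by (subst integral_scaleR_right) (simp add: 0)
  finally show ?thesis .
qed

section \<open>The space of square integrable functions\<close>

definition L2_norm_sq :: "(complex \<Rightarrow> complex) \<Rightarrow> real" where
  "L2_norm_sq f = (\<integral>z. (cmod (f z))\<^sup>2 \<partial>circle)"

lemma L2_measurable: "f \<in> L2 \<Longrightarrow> f \<in> borel_measurable circle"
  by (simp add: L2_def)

lemma L2_integrable_sq: "f \<in> L2 \<Longrightarrow> integrable circle (\<lambda>z. (cmod (f z))\<^sup>2)"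
  by (simp add: L2_def)

lemma Linf_measurable: "f \<in> Linf \<Longrightarrow> f \<in> borel_measurable circle"
  by (simp add: Linf_def)

lemma LinfI:
  "f \<in> borel_measurable circle \<Longrightarrow> (\<And>z. cmod z = 1 \<Longrightarrow> cmod (f z) \<le> C) \<Longrightarrow> f \<in> Linf"
  unfolding Linf_def using AE_circle_sphere by (auto intro!: exI[of _ C] elim: eventually_mono)

lemma L2_add:
  assumes "f \<in> L2" "g \<in> L2"
  shows "(\<lambda>z. f z + g z) \<in> L2"
proof -
  note [measurable] = L2_measurable[OF assms(1)] L2_measurable[OF assms(2)]
  have "integrable circle (\<lambda>z. (cmod (f z + g z))\<^sup>2)"
  proof (rule Bochner_Integration.integrable_bound)
    show "integrable circle (\<lambda>z. 2 * (cmod (f z))\<^sup>2 + 2 * (cmod (g z))\<^sup>2)"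
      using assms by (intro Bochner_Integration.integrable_add integrable_mult_right L2_integrable_sq)
    have "(cmod (a + b))\<^sup>2 \<le> 2 * (cmod a)\<^sup>2 + 2 * (cmod b)\<^sup>2" for a b
      using power_mono[OF norm_triangle_ineq[of a b], of 2] sum_squares_bound[of "cmod a" "cmod b"]
      by (simp add: power2_sum)
    then show "AE z in circle. norm ((cmod (f z + g z))\<^sup>2)
        \<le> norm (2 * (cmod (f z))\<^sup>2 + 2 * (cmod (g z))\<^sup>2)"
      by simp
  qed measurable
  then show ?thesis by (simp add: L2_def)
qed

lemma L2_Linf_mult:
  assumes "b \<in> Linf" "f \<in> L2"
  shows "(\<lambda>z. b z * f z) \<in> L2"
proof -
  note [measurable] = Linf_measurable[OF assms(1)] L2_measurable[OF assms(2)]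
  obtain C where C: "AE z in circle. cmod (b z) \<le> C"
    using assms(1) by (auto simp: Linf_def)
  have "integrable circle (\<lambda>z. (cmod (b z * f z))\<^sup>2)"
  proof (rule Bochner_Integration.integrable_bound)
    show "integrable circle (\<lambda>z. C\<^sup>2 * (cmod (f z))\<^sup>2)"
      using assms by (auto intro: L2_integrable_sq)
    show "AE z in circle. norm ((cmod (b z * f z))\<^sup>2) \<le> norm (C\<^sup>2 * (cmod (f z))\<^sup>2)"
      using C by eventually_elim (auto simp: norm_mult power_mult_distrib intro!: mult_right_mono power_mono)
  qed measurable
  then show ?thesis by (simp add: L2_def)
qed

lemma Linf_const: "(\<lambda>z. c) \<in> Linf"
  by (rule LinfI) auto

lemma Linf_id: "(\<lambda>z. z) \<in> Linf"
  by (rule LinfI[of _ 1]) auto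

lemma Linf_cnj: "b \<in> Linf \<Longrightarrow> (\<lambda>z. cnj (b z)) \<in> Linf"
  unfolding Linf_def by (auto intro: measurable_compose[OF _ measurable_cnj_borel])

lemma Linf_mult: "a \<in> Linf \<Longrightarrow> b \<in> Linf \<Longrightarrow> (\<lambda>z. a z * b z) \<in> Linf"
proof -
  assume a: "a \<in> Linf" and b: "b \<in> Linf"
  note [measurable] = Linf_measurable[OF a] Linf_measurable[OF b]
  obtain C D where C: "AE z in circle. cmod (a z) \<le> C" and D: "AE z in circle. cmod (b z) \<le> D"
    using a b by (auto simp: Linf_def)
  have "AE z in circle. cmod (a z * b z) \<le> C * D"
    using C D by eventually_elim (auto simp: norm_mult intro!: mult_mono intro: order_trans[OF norm_ge_zero])
  then show ?thesis by (auto simp: Linf_def)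
qed

lemma Linf_add: "a \<in> Linf \<Longrightarrow> b \<in> Linf \<Longrightarrow> (\<lambda>z. a z + b z) \<in> Linf"
proof -
  assume a: "a \<in> Linf" and b: "b \<in> Linf"
  note [measurable] = Linf_measurable[OF a] Linf_measurable[OF b]
  obtain C D where C: "AE z in circle. cmod (a z) \<le> C" and D: "AE z in circle. cmod (b z) \<le> D"
    using a b by (auto simp: Linf_def)
  have "AE z in circle. cmod (a z + b z) \<le> C + D"
    using C D by eventually_elim (metis add_mono norm_triangle_le)
  then show ?thesis by (auto simp: Linf_def)
qed

lemma Linf_diff: "a \<in> Linf \<Longrightarrow> b \<in> Linf \<Longrightarrow> (\<lambda>z. a z - b z) \<in> Linf"
  using Linf_add[of a "\<lambda>z. -1 * b z"] Linf_mult[OF Linf_const[of "-1"], of b] by simp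

lemma Linf_L2: "f \<in> Linf \<Longrightarrow> f \<in> L2"
proof -
  have "(\<lambda>z. 1) \<in> L2" by (simp add: L2_def)
  then show "f \<in> Linf \<Longrightarrow> f \<in> L2" using L2_Linf_mult[of f "\<lambda>z. 1"] by simp
qed

lemma L2_cmult: "f \<in> L2 \<Longrightarrow> (\<lambda>z. c * f z) \<in> L2"
  by (rule L2_Linf_mult[OF Linf_const])

lemma L2_diff: "f \<in> L2 \<Longrightarrow> g \<in> L2 \<Longrightarrow> (\<lambda>z. f z - g z) \<in> L2"
  using L2_add[OF _ L2_cmult[of g "-1"], of f] by simp

lemma L2_flip: "f \<in> L2 \<Longrightarrow> flip f \<in> L2"
  using integrable_circle_cnj[OF L2_integrable_sq] measurable_compose[OF measurable_cnj_circle L2_measurable]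
  by (auto simp: L2_def flip_def)

lemma Linf_flip:
  assumes "f \<in> Linf"
  shows "flip f \<in> Linf"
proof -
  obtain C where "AE z in circle. cmod (f z) \<le> C" using assms by (auto simp: Linf_def)
  from AE_circle_cnj[OF this] show ?thesis
    using measurable_compose[OF measurable_cnj_circle Linf_measurable[OF assms]]
    by (auto simp: Linf_def flip_def)
qed

lemmas Linf_intros = Linf_const Linf_id Linf_cnj Linf_mult Linf_add Linf_diff

lemma ip_integrable:
  assumes "f \<in> L2" "g \<in> L2"
  shows "integrable circle (\<lambda>z. f z * cnj (g z))"
proof (rule Bochner_Integration.integrable_bound)
  note [measurable] = L2_measurable[OF assms(1)] L2_measurable[OF assms(2)]
  show "integrable circle (\<lambda>z. (cmod (f z))\<^sup>2 + (cmod (g z))\<^sup>2)"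
    using assms by (auto intro: L2_integrable_sq)
  have "cmod a * cmod b \<le> (cmod a)\<^sup>2 + (cmod b)\<^sup>2" for a b
    using sum_squares_bound[of "cmod a" "cmod b"] mult_nonneg_nonneg[OF norm_ge_zero[of a] norm_ge_zero[of b]]
    by linarith
  then show "AE z in circle. norm (f z * cnj (g z)) \<le> norm ((cmod (f z))\<^sup>2 + (cmod (g z))\<^sup>2)"
    by (simp add: norm_mult)
  show "(\<lambda>z. f z * cnj (g z)) \<in> borel_measurable circle" by measurable
qed

lemma L2_integrable: "f \<in> L2 \<Longrightarrow> integrable circle f"
  using ip_integrable[OF _ Linf_L2[OF Linf_const[of 1]], of f] by simp

lemma ip_add_left:
  "f \<in> L2 \<Longrightarrow> g \<in> L2 \<Longrightarrow> h \<in> L2 \<Longrightarrow> ip (\<lambda>z. f z + g z) h = ip f h + ip g h"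
  by (simp add: ip_def distrib_right ip_integrable)

lemma ip_diff_left:
  "f \<in> L2 \<Longrightarrow> g \<in> L2 \<Longrightarrow> h \<in> L2 \<Longrightarrow> ip (\<lambda>z. f z - g z) h = ip f h - ip g h"
  by (simp add: ip_def left_diff_distrib ip_integrable)

lemma ip_cmult_left: "ip (\<lambda>z. c * f z) h = c * ip f h"
  by (simp add: ip_def mult.assoc)

lemma ip_commute: "ip g f = cnj (ip f g)"
  unfolding ip_def by (subst Bochner_Integration.integral_cnj[symmetric]) (simp add: mult.commute)

lemma ip_diff_right:
  "f \<in> L2 \<Longrightarrow> g \<in> L2 \<Longrightarrow> h \<in> L2 \<Longrightarrow> ip h (\<lambda>z. f z - g z) = ip h f - ip h g"
  by (subst (1 2 3) ip_commute) (simp add: ip_diff_left)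

lemma ip_cmult_right: "ip h (\<lambda>z. c * f z) = cnj c * ip h f"
  by (subst (1 2) ip_commute) (simp add: ip_cmult_left)

lemma ip_mult_left: "ip (\<lambda>z. b z * f z) g = ip f (\<lambda>z. cnj (b z) * g z)"
  by (simp add: ip_def mult_ac)

lemma ip_flip_left:
  assumes "f \<in> L2" "g \<in> L2"
  shows "ip (flip f) g = ip f (flip g)"
proof -
  note [measurable] = L2_measurable[OF assms(1)] L2_measurable[OF L2_flip[OF assms(2)]]
  have "(\<lambda>z. f z * cnj (flip g z)) \<in> borel_measurable circle" by measurable
  from integral_circle_cnj[OF this] show ?thesis by (simp add: ip_def flip_def)
qed

lemma ip_cong_AE:
  assumes "AE z in circle. f z = f' z" "f \<in> L2" "f' \<in> L2"
    and "AE z in circle. g z = g' z" "g \<in> L2" "g' \<in> L2"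
  shows "ip f g = ip f' g'"
proof -
  note [measurable] = assms(2,3,5,6)[THEN L2_measurable]
  show ?thesis unfolding ip_def
  proof (rule integral_cong_AE)
    show "AE z in circle. f z * cnj (g z) = f' z * cnj (g' z)"
      using assms(1,4) by eventually_elim simp
  qed measurable
qed

lemma ip_self: "ip f f = of_real (L2_norm_sq f)"
  unfolding ip_def L2_norm_sq_def by (subst integral_complex_of_real[symmetric]) (simp add: complex_norm_square del: integral_complex_of_real of_real_power)

lemma L2_norm_sq_nonneg: "L2_norm_sq f \<ge> 0"
  unfolding L2_norm_sq_def by (rule integral_nonneg_AE) simp

lemma AE_zero_of_ip_self:
  assumes "f \<in> L2" "ip f f = 0"
  shows "AE z in circle. f z = 0"
proof -
  have "L2_norm_sq f = 0" using assms(2) by (simp add: ip_self)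
  then show ?thesis unfolding L2_norm_sq_def
    by (subst (asm) integral_nonneg_eq_0_iff_AE) (auto intro: L2_integrable_sq assms)
qed

text \<open>
  The expansion behind both the Cauchy-Schwarz inequality and the orthogonality of a closest
  point: the best choice of \<open>t\<close> lowers the squared norm by \<open>|\<langle>f, u\<rangle>|\<^sup>2 / \<parallel>u\<parallel>\<^sup>2\<close>.
\<close>

lemma L2_norm_sq_diff_cmult:
  assumes "f \<in> L2" "u \<in> L2"
  shows "L2_norm_sq (\<lambda>z. f z - t * u z) = L2_norm_sq f - 2 * Re (cnj t * ip f u) + (cmod t)\<^sup>2 * L2_norm_sq u"
proof -
  have "complex_of_real (L2_norm_sq (\<lambda>z. f z - t * u z))
      = L2_norm_sq f - (cnj t * ip f u + cnj (cnj t * ip f u)) + t * cnj t * L2_norm_sq u"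
    using assms
    by (simp add: ip_self[symmetric] ip_diff_left ip_diff_right L2_cmult L2_diff
        ip_cmult_left ip_cmult_right ip_commute[of f u] algebra_simps)
  also have "\<dots> = of_real (L2_norm_sq f - 2 * Re (cnj t * ip f u) + (cmod t)\<^sup>2 * L2_norm_sq u)"
    by (simp only: complex_add_cnj complex_norm_square[symmetric] of_real_add of_real_diff of_real_mult of_real_power)
  finally show ?thesis by (simp only: of_real_eq_iff)
qed

lemma Cauchy_Schwarz_ip:
  assumes "f \<in> L2" "g \<in> L2"
  shows "(cmod (ip f g))\<^sup>2 \<le> L2_norm_sq f * L2_norm_sq g"
proof -
  define c where "c = (cmod (ip f g))\<^sup>2"
  \<comment> \<open>Multiples \<open>t = k \<langle>f, g\<rangle>\<close> with real \<open>k\<close> suffice, and they also settle \<open>\<parallel>g\<parallel> = 0\<close>, where the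
    right-hand side is affine in \<open>k\<close>.\<close>
  have *: "0 \<le> L2_norm_sq f - 2 * k * c + k\<^sup>2 * c * L2_norm_sq g" for k :: real
  proof -
    have "cnj (of_real k * ip f g) * ip f g = of_real (k * c)"
      unfolding c_def of_real_mult complex_norm_square by (simp add: mult_ac)
    then have "Re (cnj (of_real k * ip f g) * ip f g) = k * c"
      by (simp only: Re_complex_of_real)
    then have "L2_norm_sq (\<lambda>z. f z - of_real k * ip f g * g z) = L2_norm_sq f - 2 * k * c + k\<^sup>2 * c * L2_norm_sq g"
      unfolding L2_norm_sq_diff_cmult[OF assms] by (simp only: norm_mult norm_of_real power_mult_distrib c_def power2_abs mult.assoc)
    then show ?thesis
      using L2_norm_sq_nonneg[of "\<lambda>z. f z - of_real k * ip f g * g z"] by simp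
  qed
  show ?thesis
  proof (cases "L2_norm_sq g = 0")
    case True
    have "c = 0"
    proof (rule ccontr)
      assume "c \<noteq> 0"
      then show False using *[of "(L2_norm_sq f + 1) / (2 * c)"] True by simp
    qed
    then show ?thesis using True by (simp add: c_def)
  next
    case False
    then have "L2_norm_sq g > 0" using L2_norm_sq_nonneg[of g] by simp
    then have "c \<le> L2_norm_sq f * L2_norm_sq g"
      using *[of "1 / L2_norm_sq g"] by (simp add: power2_eq_square field_simps)
    then show ?thesis by (simp only: c_def)
  qed
qed

lemma parallelogram_L2_norm_sq:
  assumes "f \<in> L2" "a \<in> L2" "b \<in> L2"
  shows "L2_norm_sq (\<lambda>z. a z - b z) = 2 * L2_norm_sq (\<lambda>z. f z - a z) + 2 * L2_norm_sq (\<lambda>z. f z - b z)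
      - 4 * L2_norm_sq (\<lambda>z. f z - 1/2 * (a z + b z))"
proof -
  have L: "(\<lambda>z. f z - a z) \<in> L2" "(\<lambda>z. f z - b z) \<in> L2" "(\<lambda>z. f z - 1/2 * (a z + b z)) \<in> L2"
    by (rule L2_diff L2_cmult L2_add assms)+
  have "(cmod (x - y))\<^sup>2 = 2 * (cmod (w - x))\<^sup>2 + 2 * (cmod (w - y))\<^sup>2
      - 4 * (cmod (w - 1/2 * (x + y)))\<^sup>2" for w x y
    by (simp add: cmod_power2) (simp add: power2_eq_square field_simps)
  then have "L2_norm_sq (\<lambda>z. a z - b z) = (\<integral>z. 2 * (cmod (f z - a z))\<^sup>2 + 2 * (cmod (f z - b z))\<^sup>2
      - 4 * (cmod (f z - 1/2 * (a z + b z)))\<^sup>2 \<partial>circle)"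
    unfolding L2_norm_sq_def by simp
  also have "\<dots> = 2 * L2_norm_sq (\<lambda>z. f z - a z) + 2 * L2_norm_sq (\<lambda>z. f z - b z)
      - 4 * L2_norm_sq (\<lambda>z. f z - 1/2 * (a z + b z))"
    unfolding L2_norm_sq_def using L[THEN L2_integrable_sq] by simp
  finally show ?thesis .
qed

text \<open>
  Fatou's lemma, applied to the squares of the moduli. Bounds \<open>c n\<close> that vary with \<open>n\<close> are
  allowed because the closest point below is reached along a minimizing sequence.
\<close>

lemma L2_limit:
  assumes s: "\<And>n. s n \<in> L2" and g: "g \<in> borel_measurable circle"
    and lim: "AE z in circle. (\<lambda>n. s n z) \<longlonglongrightarrow> g z"
    and bound: "\<And>n. L2_norm_sq (s n) \<le> c n" and c: "c \<longlonglongrightarrow> C"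
  shows "g \<in> L2" "L2_norm_sq g \<le> C"
proof -
  note [measurable] = g L2_measurable[OF s]
  have C: "C \<ge> 0"
    using LIMSEQ_le_const[OF c] order_trans[OF L2_norm_sq_nonneg bound] by blast
  have "(\<integral>\<^sup>+z. ennreal ((cmod (g z))\<^sup>2) \<partial>circle)
      = (\<integral>\<^sup>+z. liminf (\<lambda>n. ennreal ((cmod (s n z))\<^sup>2)) \<partial>circle)"
  proof (rule nn_integral_cong_AE)
    show "AE z in circle. ennreal ((cmod (g z))\<^sup>2) = liminf (\<lambda>n. ennreal ((cmod (s n z))\<^sup>2))"
      using lim
    proof eventually_elim
      case (elim z)
      then have "(\<lambda>n. ennreal ((cmod (s n z))\<^sup>2)) \<longlonglongrightarrow> ennreal ((cmod (g z))\<^sup>2)"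
        by (intro tendsto_ennrealI tendsto_intros)
      then show ?case using lim_imp_Liminf[OF sequentially_bot] by metis
    qed
  qed
  also have "\<dots> \<le> liminf (\<lambda>n. \<integral>\<^sup>+z. ennreal ((cmod (s n z))\<^sup>2) \<partial>circle)"
    by (rule nn_integral_liminf) measurable
  also have "\<dots> = liminf (\<lambda>n. ennreal (L2_norm_sq (s n)))"
    unfolding L2_norm_sq_def using L2_integrable_sq[OF s]
    by (subst nn_integral_eq_integral) auto
  also have "\<dots> \<le> liminf (\<lambda>n. ennreal (c n))"
    by (intro Liminf_mono always_eventually allI ennreal_leI bound)
  also have "\<dots> = ennreal C"
    using c by (intro lim_imp_Liminf tendsto_ennrealI) auto
  finally have *: "(\<integral>\<^sup>+z. ennreal ((cmod (g z))\<^sup>2) \<partial>circle) \<le> ennreal C" .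
  have int: "integrable circle (\<lambda>z. (cmod (g z))\<^sup>2)"
    by (rule integrableI_bounded) (use * in \<open>auto intro: order.strict_trans1\<close>)
  then show "g \<in> L2" by (simp add: L2_def)
  show "L2_norm_sq g \<le> C"
    using * int C unfolding L2_norm_sq_def by (subst (asm) nn_integral_eq_integral) auto
qed

text \<open>
  The step of the Riesz-Fischer theorem that produces a limit. On a probability space the
  first moments of the increments are controlled by their second moments, so the increments
  are absolutely summable almost everywhere and the sequence converges by telescoping.
\<close>

lemma L2_fast_Cauchy_AE_convergent:
  assumes s: "\<And>n. s n \<in> L2"
    and fast: "\<And>n. L2_norm_sq (\<lambda>z. s (Suc n) z - s n z) \<le> (1/4) ^ n"
  obtains g where "g \<in> borel_measurable circle" "AE z in circle. (\<lambda>n. s n z) \<longlonglongrightarrow> g z"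
proof
  note [measurable] = L2_measurable[OF s]
  let ?d = "\<lambda>n z. cmod (s (Suc n) z - s n z)"
  show "(\<lambda>z. lim (\<lambda>n. s n z)) \<in> borel_measurable circle" by measurable
  have d: "(\<integral>\<^sup>+z. ennreal (?d n z) \<partial>circle) \<le> ennreal ((1/2) ^ n)" for n
  proof -
    have dL: "(\<lambda>z. s (Suc n) z - s n z) \<in> L2" using s by (intro L2_diff)
    have i: "integrable circle (?d n)"
      using L2_integrable[OF dL] by (rule integrable_norm)
    have "(\<integral>z. ?d n z \<partial>circle) \<le> (\<integral>z. (2 ^ n * (?d n z)\<^sup>2 + (1/2) ^ n) / 2 \<partial>circle)"
    proof (rule integral_mono[OF i])
      show "integrable circle (\<lambda>z. (2 ^ n * (?d n z)\<^sup>2 + (1/2) ^ n) / 2)"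
        using L2_integrable_sq[OF dL] by auto
      fix z
      \<comment> \<open>The inequality \<open>2 x \<le> 2\<^sup>n x\<^sup>2 + 2\<^sup>-\<^sup>n\<close>; its weights turn the bound \<open>4\<^sup>-\<^sup>n\<close> on second
        moments into the bound \<open>2\<^sup>-\<^sup>n\<close> on first moments.\<close>
      have "0 \<le> (1/2) ^ n * (2 ^ n * ?d n z - 1)\<^sup>2" by simp
      also have "\<dots> = 2 ^ n * (?d n z)\<^sup>2 + (1/2) ^ n - 2 * ?d n z"
        by (simp add: power2_eq_square field_simps)
      finally show "?d n z \<le> (2 ^ n * (?d n z)\<^sup>2 + (1/2) ^ n) / 2" by simp
    qed
    also have "\<dots> = (2 ^ n * L2_norm_sq (\<lambda>z. s (Suc n) z - s n z) + (1/2) ^ n) / 2"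
      unfolding L2_norm_sq_def using L2_integrable_sq[OF dL] by simp
    also have "\<dots> \<le> (2 ^ n * (1/4) ^ n + (1/2) ^ n) / 2"
      using fast[of n] by simp
    also have "2 ^ n * (1/4) ^ n = (1/2 :: real) ^ n"
      by (simp flip: power_mult_distrib)
    finally show ?thesis
      by (subst nn_integral_eq_integral[OF i]) auto
  qed
  have "(\<integral>\<^sup>+z. (\<Sum>n. ennreal (?d n z)) \<partial>circle) = (\<Sum>n. \<integral>\<^sup>+z. ennreal (?d n z) \<partial>circle)"
    by (rule nn_integral_suminf) measurable
  also have "\<dots> \<le> (\<Sum>n. ennreal ((1/2) ^ n))"
    by (intro suminf_le d) auto
  also have "\<dots> = ennreal (\<Sum>n. (1/2) ^ n)"
    by (intro suminf_ennreal2) (auto intro: summable_geometric)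
  also have "\<dots> < \<infinity>" by simp
  finally have fin: "(\<integral>\<^sup>+z. (\<Sum>n. ennreal (?d n z)) \<partial>circle) \<noteq> \<infinity>" by simp
  have "AE z in circle. (\<Sum>n. ennreal (?d n z)) \<noteq> \<infinity>"
    by (rule nn_integral_PInf_AE[OF _ fin]) measurable
  then show "AE z in circle. (\<lambda>n. s n z) \<longlonglongrightarrow> lim (\<lambda>n. s n z)"
  proof eventually_elim
    case (elim z)
    then have "summable (\<lambda>n. ?d n z)"
      by (intro summable_suminf_not_top) auto
    then have "summable (\<lambda>n. s (Suc n) z - s n z)"
      by (rule summable_norm_cancel)
    then have "(\<lambda>n. \<Sum>i<n. s (Suc i) z - s i z) \<longlonglongrightarrow> (\<Sum>i. s (Suc i) z - s i z)"
      by (rule summable_LIMSEQ)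
    then have "(\<lambda>n. s n z - s 0 z) \<longlonglongrightarrow> (\<Sum>i. s (Suc i) z - s i z)"
      by (simp add: sum_lessThan_telescope[of "\<lambda>n. s n z"])
    from tendsto_add[OF this tendsto_const[of "s 0 z"]] have "convergent (\<lambda>n. s n z)"
      by (auto simp: convergent_def)
    then show ?case by (simp add: convergent_LIMSEQ_iff)
  qed
qed

section \<open>Orthogonal projections\<close>

lemma ominusD: "f \<in> L2 \<ominus> E \<Longrightarrow> f \<in> L2" "f \<in> L2 \<ominus> E \<Longrightarrow> g \<in> E \<Longrightarrow> ip f g = 0"
  by (auto simp: ominus_def)

lemma ominusI: "f \<in> L2 \<Longrightarrow> (\<And>g. g \<in> E \<Longrightarrow> ip f g = 0) \<Longrightarrow> f \<in> L2 \<ominus> E"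
  by (auto simp: ominus_def)

lemma ominus_swap: "f \<in> E \<Longrightarrow> g \<in> L2 \<ominus> E \<Longrightarrow> ip f g = 0"
  using ip_commute[of f g] by (simp add: ominus_def)

lemma ominus_cmult: "f \<in> L2 \<ominus> E \<Longrightarrow> (\<lambda>z. c * f z) \<in> L2 \<ominus> E"
  by (auto simp: ominus_def ip_cmult_left L2_cmult)

context
  fixes E assumes E: "E \<subseteq> L2"
begin

lemma ominus_add: "f \<in> L2 \<ominus> E \<Longrightarrow> g \<in> L2 \<ominus> E \<Longrightarrow> (\<lambda>z. f z + g z) \<in> L2 \<ominus> E"
  using E by (auto simp: ominus_def ip_add_left L2_add subset_iff)

lemma ominus_diff: "f \<in> L2 \<ominus> E \<Longrightarrow> g \<in> L2 \<ominus> E \<Longrightarrow> (\<lambda>z. f z - g z) \<in> L2 \<ominus> E"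
  using E by (auto simp: ominus_def ip_diff_left L2_diff subset_iff)

text \<open>
  The classical argument for closed subspaces: a minimizing sequence is a Cauchy sequence by the
  parallelogram law. Here the subspace is closed because it is cut out by the conditions
  \<open>\<langle>u, e\<rangle> = 0\<close>, which survive limits in norm by the Cauchy-Schwarz inequality.
\<close>

lemma ominus_closest_point:
  assumes f: "f \<in> L2"
  obtains g where "g \<in> L2 \<ominus> E"
    and "\<And>u. u \<in> L2 \<ominus> E \<Longrightarrow> L2_norm_sq (\<lambda>z. f z - g z) \<le> L2_norm_sq (\<lambda>z. f z - u z)"
proof -
  let ?M = "L2 \<ominus> E"
  define d where "d = (INF u\<in>?M. L2_norm_sq (\<lambda>z. f z - u z))"
  \<comment> \<open>The tolerance is small enough for consecutive terms of the minimizing sequence to differ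
    in squared norm by at most \<open>4\<^sup>-\<^sup>n\<close>.\<close>
  define e where "e n = (1/4 :: real) ^ n / 4" for n
  have bdd: "bdd_below ((\<lambda>u. L2_norm_sq (\<lambda>z. f z - u z)) ` ?M)"
    by (rule bdd_belowI2[of _ 0]) (rule L2_norm_sq_nonneg)
  have le: "d \<le> L2_norm_sq (\<lambda>z. f z - u z)" if "u \<in> ?M" for u
    unfolding d_def by (rule cINF_lower[OF bdd that])
  have ne: "?M \<noteq> {}"
  proof -
    have "(\<lambda>z. 0) \<in> ?M" by (auto simp: ominus_def ip_def intro: Linf_L2 Linf_const)
    then show ?thesis by blast
  qed
  have "\<exists>u\<in>?M. L2_norm_sq (\<lambda>z. f z - u z) < d + e n" for n
    using cInf_lessD[of "(\<lambda>u. L2_norm_sq (\<lambda>z. f z - u z)) ` ?M" "d + e n"] ne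
    by (auto simp: d_def e_def)
  then obtain s where sM: "\<And>n. s n \<in> ?M" and s: "\<And>n. L2_norm_sq (\<lambda>z. f z - s n z) < d + e n"
    by metis
  have sL: "s n \<in> L2" for n using sM by (rule ominusD)
  \<comment> \<open>The midpoint of two almost closest points is no closer than \<open>d\<close>, so by the
    parallelogram law the two points are close to each other.\<close>
  have close: "L2_norm_sq (\<lambda>z. s m z - s n z) \<le> 2 * e m + 2 * e n" for m n
  proof -
    have "d \<le> L2_norm_sq (\<lambda>z. f z - 1/2 * (s m z + s n z))"
      by (rule le[OF ominus_cmult[OF ominus_add[OF sM sM]]])
    then show ?thesis
      using parallelogram_L2_norm_sq[OF f sL[of m] sL[of n]] s[of m] s[of n] by simp
  qed
  have "L2_norm_sq (\<lambda>z. s (Suc n) z - s n z) \<le> (1/4) ^ n" for n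
  proof -
    have "2 * e (Suc n) + 2 * e n \<le> (1/4) ^ n" by (simp add: e_def)
    then show ?thesis using close[of "Suc n" n] by linarith
  qed
  then obtain g where g: "g \<in> borel_measurable circle" "AE z in circle. (\<lambda>n. s n z) \<longlonglongrightarrow> g z"
    using L2_fast_Cauchy_AE_convergent[of s] sL by metis
  note [measurable] = g(1) L2_measurable[OF f] L2_measurable[OF sL]
  have e0: "e \<longlonglongrightarrow> 0"
    unfolding e_def by real_asymp
  have near: "(\<lambda>z. g z - s n z) \<in> L2" "L2_norm_sq (\<lambda>z. g z - s n z) \<le> 2 * 0 + 2 * e n" for n
  proof -
    have 1: "AE z in circle. (\<lambda>m. s m z - s n z) \<longlonglongrightarrow> g z - s n z"
      using g(2) by eventually_elim (intro tendsto_intros)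
    have 2: "(\<lambda>m. 2 * e m + 2 * e n) \<longlonglongrightarrow> 2 * 0 + 2 * e n"
      by (intro tendsto_intros e0)
    show "(\<lambda>z. g z - s n z) \<in> L2" "L2_norm_sq (\<lambda>z. g z - s n z) \<le> 2 * 0 + 2 * e n"
      using L2_limit[OF L2_diff[OF sL sL] _ 1 close 2] by auto
  qed
  have gL: "g \<in> L2"
    using L2_add[OF near(1) sL, of 0 0] by simp
  have "ip g u = 0" if u: "u \<in> E" for u
  proof -
    have uL: "u \<in> L2" using u E by auto
    have "(cmod (ip g u))\<^sup>2 \<le> 2 * e n * L2_norm_sq u" for n
    proof -
      have "ip g u = ip (\<lambda>z. g z - s n z) u"
        using ominusD(2)[OF sM u] by (simp add: ip_diff_left gL sL uL)
      then have "(cmod (ip g u))\<^sup>2 \<le> L2_norm_sq (\<lambda>z. g z - s n z) * L2_norm_sq u"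
        using Cauchy_Schwarz_ip[OF near(1) uL] by simp
      also have "\<dots> \<le> 2 * e n * L2_norm_sq u"
        using near(2)[of n] by (intro mult_right_mono L2_norm_sq_nonneg) simp
      finally show ?thesis .
    qed
    moreover have "(\<lambda>n. 2 * e n * L2_norm_sq u) \<longlonglongrightarrow> 2 * 0 * L2_norm_sq u"
      by (intro tendsto_intros e0)
    ultimately have "(cmod (ip g u))\<^sup>2 \<le> 0"
      using LIMSEQ_le_const by fastforce
    then show ?thesis by simp
  qed
  with gL have gM: "g \<in> ?M" by (rule ominusI)
  have "L2_norm_sq (\<lambda>z. f z - g z) \<le> d"
  proof (rule L2_limit(2)[where s = "\<lambda>n z. f z - s n z" and c = "\<lambda>n. d + e n"])
    show "AE z in circle. (\<lambda>n. f z - s n z) \<longlonglongrightarrow> f z - g z"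
      using g(2) by eventually_elim (intro tendsto_intros)
    show "(\<lambda>n. d + e n) \<longlonglongrightarrow> d"
      using tendsto_add[OF tendsto_const e0] by simp
  qed (use s f sL in \<open>auto intro: L2_diff less_imp_le\<close>)
  then show thesis
    using that[OF gM] le by (meson order_trans)
qed

text \<open>
  The function chosen in the definition of \<open>orth_proj\<close> has the defining property of the
  orthogonal projection as soon as some function does. An orthogonal complement is general
  enough for this development, because the Hardy space is the complement of the negative powers
  of \<open>z\<close>.
\<close>

theorem orth_proj_ominus:
  assumes f: "f \<in> L2"
  shows "orth_proj (L2 \<ominus> E) f \<in> L2 \<ominus> E"
    and "(\<lambda>z. f z - orth_proj (L2 \<ominus> E) f z) \<in> L2 \<ominus> (L2 \<ominus> E)"
proof -
  obtain g where g: "g \<in> L2 \<ominus> E"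
    and min: "\<And>u. u \<in> L2 \<ominus> E \<Longrightarrow> L2_norm_sq (\<lambda>z. f z - g z) \<le> L2_norm_sq (\<lambda>z. f z - u z)"
    using ominus_closest_point[OF f] by blast
  have fg: "(\<lambda>z. f z - g z) \<in> L2"
    using f g by (auto intro: L2_diff ominusD)
  have "ip (\<lambda>z. f z - g z) u = 0" if u: "u \<in> L2 \<ominus> E" for u
  proof (rule ccontr)
    let ?p = "ip (\<lambda>z. f z - g z) u"
    assume p: "?p \<noteq> 0"
    have uL: "u \<in> L2" using u by (rule ominusD)
    from p Cauchy_Schwarz_ip[OF fg uL] have N: "L2_norm_sq u > 0"
      using L2_norm_sq_nonneg[of u] by (cases "L2_norm_sq u = 0") auto
    \<comment> \<open>Moving from \<open>g\<close> to the foot of the perpendicular on the line \<open>g + \<complex> u\<close> would bring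
      it closer to \<open>f\<close>.\<close>
    define t where "t = ?p / of_real (L2_norm_sq u)"
    have "(\<lambda>z. g z + t * u z) \<in> L2 \<ominus> E"
      by (intro ominus_add ominus_cmult g u)
    from min[OF this] have "L2_norm_sq (\<lambda>z. f z - g z) \<le> L2_norm_sq (\<lambda>z. (f z - g z) - t * u z)"
      by (simp add: diff_diff_eq)
    also have "\<dots> = L2_norm_sq (\<lambda>z. f z - g z) - (cmod ?p)\<^sup>2 / L2_norm_sq u"
    proof -
      have "cnj t * ?p = of_real ((cmod ?p)\<^sup>2 / L2_norm_sq u)"
        unfolding t_def of_real_divide complex_norm_square by simp
      moreover have "(cmod t)\<^sup>2 * L2_norm_sq u = (cmod ?p)\<^sup>2 / L2_norm_sq u"
        using N by (simp add: t_def norm_divide power2_eq_square)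
      ultimately show ?thesis
        unfolding L2_norm_sq_diff_cmult[OF fg uL] by simp
    qed
    also have "\<dots> < L2_norm_sq (\<lambda>z. f z - g z)"
      using N p by simp
    finally show False by simp
  qed
  with fg have "(\<lambda>z. f z - g z) \<in> L2 \<ominus> (L2 \<ominus> E)"
    by (rule ominusI)
  with g have "\<exists>g. g \<in> L2 \<ominus> E \<and> (\<lambda>z. f z - g z) \<in> L2 \<ominus> (L2 \<ominus> E)"
    by blast
  from someI_ex[OF this] show "orth_proj (L2 \<ominus> E) f \<in> L2 \<ominus> E"
    and "(\<lambda>z. f z - orth_proj (L2 \<ominus> E) f z) \<in> L2 \<ominus> (L2 \<ominus> E)"
    by (auto simp: orth_proj_def)
qed

end

section \<open>The Hardy space and inner functions\<close>

lemma cnj_mult_circle: "cmod z = 1 \<Longrightarrow> cnj z * z = 1"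
  by (metis complex_norm_square mult.commute of_real_1 one_power2)

lemma integral_circle_cong:
  "(\<And>z. cmod z = 1 \<Longrightarrow> f z = g z) \<Longrightarrow> (\<integral>z. f z \<partial>circle) = (\<integral>z. g z \<partial>circle)"
  by (rule Bochner_Integration.integral_cong) auto

lemma Linf_power: "(\<lambda>z. z ^ m) \<in> Linf"
  by (rule LinfI[of _ 1]) (auto simp: norm_power)

lemma Linf_powi: "(\<lambda>z. z powi n) \<in> Linf"
proof (rule LinfI[of _ 1])
  show "(\<lambda>z. z powi n) \<in> borel_measurable circle"
    unfolding power_int_def by (cases "n \<ge> 0") auto
qed (simp add: norm_power_int)

lemma ip_powi_minus: "ip f (\<lambda>z. z powi (- int m)) = (\<integral>z. f z * z ^ m \<partial>circle)"
proof -
  have "cnj (z powi (- int m)) = z ^ m" if "cmod z = 1" for z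
  proof -
    have "inverse z = cnj z"
      using cnj_mult_circle[OF that] by (metis inverse_unique mult.commute)
    then show ?thesis by (simp add: power_int_minus flip: power_inverse)
  qed
  then show ?thesis
    unfolding ip_def by (intro integral_circle_cong) simp
qed

lemma H2_eq: "H2 = L2 \<ominus> {\<lambda>z. z powi n | n. n < 0}"
  by (auto simp: H2_def ominus_def fourier_coeff_def)

lemma powi_subset_L2: "{\<lambda>z. z powi n | n :: int. n < 0} \<subseteq> L2"
  using Linf_L2[OF Linf_powi] by auto

lemma H2_L2: "f \<in> H2 \<Longrightarrow> f \<in> L2"
  by (simp add: H2_def)

text \<open>
  Membership in the Hardy space is tested by moments: on the circle the conjugate of
  \<open>z\<^sup>-\<^sup>m\<close> is \<open>z\<^sup>m\<close>.
\<close>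

lemma H2I:
  assumes "f \<in> L2" "\<And>m. m > 0 \<Longrightarrow> (\<integral>z. f z * z ^ m \<partial>circle) = 0"
  shows "f \<in> H2"
  unfolding H2_def fourier_coeff_def
proof safe
  fix n :: int assume "n < 0"
  then have "ip f (\<lambda>z. z powi n) = (\<integral>z. f z * z ^ nat (- n) \<partial>circle)"
    using ip_powi_minus[of f "nat (- n)"] by simp
  then show "ip f (\<lambda>z. z powi n) = 0"
    using assms(2)[of "nat (- n)"] \<open>n < 0\<close> by simp
qed fact

lemma H2_moment: "f \<in> H2 \<Longrightarrow> m > 0 \<Longrightarrow> (\<integral>z. f z * z ^ m \<partial>circle) = 0"
  using ip_powi_minus[of f m] by (simp add: H2_def fourier_coeff_def)

lemma fourier_coeff_0: "fourier_coeff f 0 = (\<integral>z. f z \<partial>circle)"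
  by (simp add: fourier_coeff_def ip_def)

lemma H2_add: "f \<in> H2 \<Longrightarrow> g \<in> H2 \<Longrightarrow> (\<lambda>z. f z + g z) \<in> H2"
  unfolding H2_eq by (rule ominus_add[OF powi_subset_L2])

lemma H2_diff: "f \<in> H2 \<Longrightarrow> g \<in> H2 \<Longrightarrow> (\<lambda>z. f z - g z) \<in> H2"
  unfolding H2_eq by (rule ominus_diff[OF powi_subset_L2])

lemma H2_cmult: "f \<in> H2 \<Longrightarrow> (\<lambda>z. c * f z) \<in> H2"
  unfolding H2_eq by (rule ominus_cmult)

lemma H2_const: "(\<lambda>z. c) \<in> H2"
  by (rule H2I) (auto intro: Linf_L2 Linf_const simp: integral_circle_power)

lemma H2_shift:
  assumes "f \<in> H2"
  shows "(\<lambda>z. z * f z) \<in> H2"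
proof (rule H2I)
  show "(\<lambda>z. z * f z) \<in> L2" using assms by (intro L2_Linf_mult Linf_id H2_L2)
  show "(\<integral>z. z * f z * z ^ m \<partial>circle) = 0" for m
    using H2_moment[OF assms, of "Suc m"] by (simp add: mult_ac)
qed

lemma H2_backward_shift:
  assumes "f \<in> H2"
  shows "(\<lambda>z. cnj z * (f z - fourier_coeff f 0)) \<in> H2"
proof (rule H2I)
  let ?c = "fourier_coeff f 0"
  show "(\<lambda>z. cnj z * (f z - ?c)) \<in> L2"
    using assms by (intro L2_Linf_mult L2_diff H2_L2 Linf_L2 Linf_intros)
  fix m :: nat assume "m > 0"
  then obtain k where m: "m = Suc k" by (cases m) auto
  have "(\<integral>z. cnj z * (f z - ?c) * z ^ m \<partial>circle) = (\<integral>z. f z * z ^ k - ?c * z ^ k \<partial>circle)"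
  proof (rule integral_circle_cong)
    fix z :: complex assume "cmod z = 1"
    then have "cnj z * z = 1" by (rule cnj_mult_circle)
    moreover have "cnj z * (f z - ?c) * z ^ m = cnj z * z * ((f z - ?c) * z ^ k)"
      unfolding m power_Suc by (simp only: mult_ac)
    ultimately show "cnj z * (f z - ?c) * z ^ m = f z * z ^ k - ?c * z ^ k"
      by (simp add: left_diff_distrib)
  qed
  also have "\<dots> = (\<integral>z. f z * z ^ k \<partial>circle) - ?c * (\<integral>z. z ^ k \<partial>circle)"
  proof -
    have "integrable circle (\<lambda>z. z ^ k * f z)" "integrable circle (\<lambda>z. z ^ k)"
      using L2_integrable[OF L2_Linf_mult[OF Linf_power H2_L2[OF assms]]]
        L2_integrable[OF Linf_L2[OF Linf_power]] by auto
    then show ?thesis by (simp add: mult.commute)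
  qed
  also have "\<dots> = 0"
    by (cases "k = 0") (auto simp: fourier_coeff_0 H2_moment[OF assms] integral_circle_power)
  finally show "(\<integral>z. cnj z * (f z - ?c) * z ^ m \<partial>circle) = 0" .
qed

lemma ip_cnj_H2: "f \<in> H2 \<Longrightarrow> ip f cnj = 0"
  using H2_moment[of f 1] by (simp add: ip_def)

context
  fixes \<theta> assumes inner: "inner_function \<theta>"
begin

lemma inner_Linf: "\<theta> \<in> Linf"
  using inner by (auto simp: inner_function_def Linf_def intro!: exI[of _ 1] elim: eventually_mono)

lemma inner_unimodular: "AE z in circle. cnj (\<theta> z) * \<theta> z = 1"
proof -
  have "AE z in circle. cmod (\<theta> z) = 1" using inner by (simp add: inner_function_def)
  then show ?thesis by eventually_elim (rule cnj_mult_circle)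
qed

lemma inner_L2: "\<theta> \<in> L2"
  by (rule Linf_L2[OF inner_Linf])

lemma inner_mult_L2: "u \<in> L2 \<Longrightarrow> (\<lambda>z. \<theta> z * u z) \<in> L2"
  by (rule L2_Linf_mult[OF inner_Linf])

text \<open>
  On a circle of radius \<open>r < 1\<close> the power series of \<open>\<theta>\<close> converges uniformly, so the dilate
  \<open>\<theta>(r z)\<close> may be treated as a polynomial in \<open>z\<close>.
\<close>

lemma dilate_moment:
  assumes u: "u \<in> H2" and m: "m > 0" and r: "0 < r" "r < 1"
  shows "(\<lambda>z. \<theta> (of_real r * z)) \<in> borel_measurable circle"
    and "(\<integral>z. \<theta> (of_real r * z) * (u z * z ^ m) \<partial>circle) = 0"
proof -
  note [measurable] = L2_measurable[OF H2_L2[OF u]]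
  define a where "a n = (deriv ^^ n) \<theta> 0 / fact n" for n
  have sums: "(\<lambda>n. a n * w ^ n) sums \<theta> w" if "cmod w < 1" for w
    using holomorphic_power_series[of \<theta> 0 1 w] inner that
    by (simp add: inner_function_def a_def)
  define \<rho> where "\<rho> = (r + 1) / 2"
  have \<rho>: "r < \<rho>" "\<rho> < 1" using r by (auto simp: \<rho>_def)
  have "summable (\<lambda>n. a n * of_real \<rho> ^ n)"
    using sums[of "of_real \<rho>"] \<rho> r by (auto simp: sums_iff)
  then have "summable (\<lambda>n. norm (a n * of_real r ^ n))"
    by (rule powser_insidea) (use r \<rho> in auto)
  then have abs: "summable (\<lambda>n. cmod (a n) * r ^ n)"
    using r by (simp add: norm_mult norm_power)
  let ?s = "\<lambda>N z. \<Sum>n<N. a n * (of_real r * z) ^ n"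
  have lim: "(\<lambda>N. ?s N z) \<longlonglongrightarrow> \<theta> (of_real r * z)" if "cmod z = 1" for z
    using sums[of "of_real r * z"] that r by (simp add: sums_def norm_mult)
  show meas [measurable]: "(\<lambda>z. \<theta> (of_real r * z)) \<in> borel_measurable circle"
    by (rule borel_measurable_LIMSEQ_metric[where f = ?s]) (use lim in auto)
  have bd: "cmod (?s N z) \<le> (\<Sum>n. cmod (a n) * r ^ n)" if "cmod z = 1" for N z
  proof -
    have "cmod (?s N z) \<le> (\<Sum>n<N. cmod (a n) * r ^ n)"
      by (rule order_trans[OF norm_sum]) (use r that in \<open>auto simp: norm_mult norm_power\<close>)
    also have "\<dots> \<le> (\<Sum>n. cmod (a n) * r ^ n)"
      by (rule sum_le_suminf[OF abs]) (use r in auto)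
    finally show ?thesis .
  qed
  have umL: "(\<lambda>z. u z * z ^ m) \<in> L2"
    using L2_Linf_mult[OF Linf_power[of m] H2_L2[OF u]] by (simp add: mult.commute)
  have "(\<lambda>N. \<integral>z. ?s N z * (u z * z ^ m) \<partial>circle)
      \<longlonglongrightarrow> (\<integral>z. \<theta> (of_real r * z) * (u z * z ^ m) \<partial>circle)"
  proof (rule integral_dominated_convergence[where w = "\<lambda>z. (\<Sum>n. cmod (a n) * r ^ n) * cmod (u z * z ^ m)"])
    show "integrable circle (\<lambda>z. (\<Sum>n. cmod (a n) * r ^ n) * cmod (u z * z ^ m))"
      using L2_integrable[OF umL] by (intro integrable_mult_right integrable_norm)
    show "AE z in circle. (\<lambda>N. ?s N z * (u z * z ^ m)) \<longlonglongrightarrow> \<theta> (of_real r * z) * (u z * z ^ m)"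
      using AE_circle_sphere by eventually_elim (intro tendsto_intros lim)
    show "AE z in circle. norm (?s N z * (u z * z ^ m))
        \<le> (\<Sum>n. cmod (a n) * r ^ n) * cmod (u z * z ^ m)" for N
      using AE_circle_sphere
      by eventually_elim (simp only: norm_mult, intro mult_right_mono bd mult_nonneg_nonneg norm_ge_zero)
  qed measurable
  moreover have "(\<integral>z. ?s N z * (u z * z ^ m) \<partial>circle) = 0" for N
  proof -
    have i: "integrable circle (\<lambda>z. u z * z ^ (n + m))" for n
      using L2_integrable[OF L2_Linf_mult[OF Linf_power[of "n + m"] H2_L2[OF u]]]
      by (simp add: mult.commute)
    have "(\<integral>z. ?s N z * (u z * z ^ m) \<partial>circle)
        = (\<integral>z. (\<Sum>n<N. a n * of_real r ^ n * (u z * z ^ (n + m))) \<partial>circle)"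
      by (intro integral_circle_cong) (simp add: sum_distrib_left sum_distrib_right power_mult_distrib power_add mult_ac)
    also have "\<dots> = (\<Sum>n<N. \<integral>z. a n * of_real r ^ n * (u z * z ^ (n + m)) \<partial>circle)"
      by (rule Bochner_Integration.integral_sum) (intro integrable_mult_right i)
    also have "\<dots> = 0"
      using H2_moment[OF u] m by simp
    finally show ?thesis .
  qed
  ultimately show "(\<integral>z. \<theta> (of_real r * z) * (u z * z ^ m) \<partial>circle) = 0"
    by (simp add: LIMSEQ_const_iff)
qed

text \<open>
  The dilates of \<open>\<theta>\<close> are bounded and converge to \<open>\<theta>\<close> almost everywhere, so their vanishing
  moments pass to the limit.
\<close>

lemma inner_mult_H2:
  assumes u: "u \<in> H2"
  shows "(\<lambda>z. \<theta> z * u z) \<in> H2"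
proof (rule H2I)
  show "(\<lambda>z. \<theta> z * u z) \<in> L2" by (rule inner_mult_L2[OF H2_L2[OF u]])
  fix m :: nat assume m: "m > 0"
  note [measurable] = L2_measurable[OF H2_L2[OF u]] Linf_measurable[OF inner_Linf]
  define r where "r k = 1 - 1 / (real k + 2)" for k
  have r: "0 < r k" "r k < 1" for k by (auto simp: r_def)
  have rlim: "filterlim r (at_left 1) sequentially"
    unfolding r_def by real_asymp
  obtain C where C: "\<And>w. cmod w < 1 \<Longrightarrow> cmod (\<theta> w) \<le> C"
  proof -
    from inner obtain C where "\<forall>x\<in>\<theta> ` ball 0 1. cmod x \<le> C"
      unfolding inner_function_def bounded_iff by blast
    then show thesis using that[of C] by simp
  qed
  note [measurable] = dilate_moment(1)[OF u m r]
  have umL: "(\<lambda>z. u z * z ^ m) \<in> L2"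
    using L2_Linf_mult[OF Linf_power[of m] H2_L2[OF u]] by (simp add: mult.commute)
  have "(\<lambda>k. \<integral>z. \<theta> (of_real (r k) * z) * (u z * z ^ m) \<partial>circle)
      \<longlonglongrightarrow> (\<integral>z. \<theta> z * (u z * z ^ m) \<partial>circle)"
  proof (rule integral_dominated_convergence[where w = "\<lambda>z. C * cmod (u z * z ^ m)"])
    show "integrable circle (\<lambda>z. C * cmod (u z * z ^ m))"
      using L2_integrable[OF umL] by (intro integrable_mult_right integrable_norm)
    have "AE z in circle. ((\<lambda>r. \<theta> (of_real r * z)) \<longlongrightarrow> \<theta> z) (at_left 1)"
      using inner by (simp add: inner_function_def)
    then show "AE z in circle. (\<lambda>k. \<theta> (of_real (r k) * z) * (u z * z ^ m)) \<longlonglongrightarrow> \<theta> z * (u z * z ^ m)"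
      by eventually_elim (intro tendsto_intros filterlim_compose[OF _ rlim])
    show "AE z in circle. norm (\<theta> (of_real (r k) * z) * (u z * z ^ m)) \<le> C * cmod (u z * z ^ m)" for k
      using AE_circle_sphere
    proof eventually_elim
      case (elim z)
      then have "cmod (\<theta> (of_real (r k) * z)) \<le> C"
        using r[of k] by (intro C) (simp add: norm_mult)
      then show ?case
        by (simp only: norm_mult) (intro mult_right_mono mult_nonneg_nonneg norm_ge_zero)
    qed
  qed measurable
  then show "(\<integral>z. \<theta> z * u z * z ^ m \<partial>circle) = 0"
    by (simp add: dilate_moment(2)[OF u m r] LIMSEQ_const_iff mult.assoc)
qed

lemma inner_H2: "\<theta> \<in> H2"
  using inner_mult_H2[OF H2_const[of 1]] by simp

text \<open>
  Evaluation at the centre of the disk is multiplicative: \<open>\<theta> u\<close> and \<open>u(0) \<theta>\<close> differ by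
  \<open>z\<close> times a function of the Hardy space.
\<close>

lemma integral_inner_mult:
  assumes u: "u \<in> H2"
  shows "(\<integral>z. \<theta> z * u z \<partial>circle) = fourier_coeff \<theta> 0 * fourier_coeff u 0"
proof -
  let ?c = "fourier_coeff u 0"
  have "0 = (\<integral>z. \<theta> z * (cnj z * (u z - ?c)) * z ^ 1 \<partial>circle)"
    by (rule H2_moment[OF inner_mult_H2[OF H2_backward_shift[OF u]], symmetric]) simp
  also have "\<dots> = (\<integral>z. \<theta> z * u z - ?c * \<theta> z \<partial>circle)"
  proof (rule integral_circle_cong)
    fix z :: complex assume "cmod z = 1"
    then have "cnj z * z = 1" by (rule cnj_mult_circle)
    then show "\<theta> z * (cnj z * (u z - ?c)) * z ^ 1 = \<theta> z * u z - ?c * \<theta> z"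
      by algebra
  qed
  also have "\<dots> = (\<integral>z. \<theta> z * u z \<partial>circle) - ?c * (\<integral>z. \<theta> z \<partial>circle)"
    using L2_integrable[OF inner_mult_L2[OF H2_L2[OF u]]] L2_integrable[OF inner_L2] by simp
  finally show ?thesis
    by (simp add: fourier_coeff_0 mult.commute)
qed

end

section \<open>The projection onto the complement of the model space\<close>

lemma P_H2:
  assumes "f \<in> L2"
  shows "P f \<in> H2" "(\<lambda>z. f z - P f z) \<in> L2 \<ominus> H2"
  using orth_proj_ominus[OF powi_subset_L2 assms] by (simp_all add: P_def H2_eq)

lemma ip_P:
  assumes "f \<in> L2" "u \<in> H2"
  shows "ip (P f) u = ip f u"
  using ominusD(2)[OF P_H2(2)[OF assms(1)] assms(2)] P_H2(1)[OF assms(1)] assms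
  by (simp add: ip_diff_left H2_L2)

lemma K_perp_L2: "q \<in> K_perp \<theta> \<Longrightarrow> q \<in> L2"
  unfolding K_perp_def by (rule ominusD)

context
  fixes \<theta> assumes inner: "inner_function \<theta>"
begin

lemma K_iff: "k \<in> K \<theta> \<longleftrightarrow> k \<in> H2 \<and> (\<forall>u\<in>H2. ip k (\<lambda>z. \<theta> z * u z) = 0)"
proof -
  have "ip k g = 0" if k: "k \<in> H2" and *: "\<forall>u\<in>H2. ip k (\<lambda>z. \<theta> z * u z) = 0" and g: "g \<in> mult_H2 \<theta>" for g
  proof -
    obtain u where u: "u \<in> H2" "AE z in circle. g z = \<theta> z * u z" and gL: "g \<in> L2"
      using g by (auto simp: mult_H2_def)
    have "ip k g = ip k (\<lambda>z. \<theta> z * u z)"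
      using u gL k by (intro ip_cong_AE) (auto intro: inner_mult_L2[OF inner] H2_L2)
    then show ?thesis using * u by simp
  qed
  moreover have "(\<lambda>z. \<theta> z * u z) \<in> mult_H2 \<theta>" if "u \<in> H2" for u
    using that by (auto simp: mult_H2_def intro: inner_mult_L2[OF inner] H2_L2)
  ultimately show ?thesis
    by (auto simp: K_def ominus_def)
qed

lemma K_H2: "k \<in> K \<theta> \<Longrightarrow> k \<in> H2"
  by (simp add: K_iff)

lemma K_L2: "k \<in> K \<theta> \<Longrightarrow> k \<in> L2"
  by (rule H2_L2[OF K_H2])

lemma K_orth: "k \<in> K \<theta> \<Longrightarrow> u \<in> H2 \<Longrightarrow> ip k (\<lambda>z. \<theta> z * u z) = 0"
  by (simp add: K_iff)

lemma K_subset_L2: "K \<theta> \<subseteq> L2"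
  using K_L2 by blast

lemma K_add: "k \<in> K \<theta> \<Longrightarrow> l \<in> K \<theta> \<Longrightarrow> (\<lambda>z. k z + l z) \<in> K \<theta>"
  by (auto simp: K_iff H2_add ip_add_left H2_L2 inner_mult_L2[OF inner])

lemma K_diff: "k \<in> K \<theta> \<Longrightarrow> l \<in> K \<theta> \<Longrightarrow> (\<lambda>z. k z - l z) \<in> K \<theta>"
  by (auto simp: K_iff H2_diff ip_diff_left H2_L2 inner_mult_L2[OF inner])

lemma K_cmult: "k \<in> K \<theta> \<Longrightarrow> (\<lambda>z. c * k z) \<in> K \<theta>"
  by (auto simp: K_iff H2_cmult ip_cmult_left)

lemmas K_perp_add = ominus_add[OF K_subset_L2, folded K_perp_def]
lemmas K_perp_diff = ominus_diff[OF K_subset_L2, folded K_perp_def]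
lemmas K_perp_cmult = ominus_cmult[where E = "K \<theta>", folded K_perp_def]

lemma ip_K_perp_K: "q \<in> K_perp \<theta> \<Longrightarrow> k \<in> K \<theta> \<Longrightarrow> ip q k = 0"
  unfolding K_perp_def by (rule ominusD)

lemma ip_K_K_perp: "q \<in> K_perp \<theta> \<Longrightarrow> k \<in> K \<theta> \<Longrightarrow> ip k q = 0"
  unfolding K_perp_def by (rule ominus_swap)

lemma cnj_K_perp: "cnj \<in> K_perp \<theta>"
proof -
  have "cnj \<in> L2" using Linf_L2[OF Linf_cnj[OF Linf_id]] .
  moreover have "ip cnj k = 0" if "k \<in> K \<theta>" for k
    using ip_cnj_H2[OF K_H2[OF that]] ip_commute[of cnj k] by simp
  ultimately show ?thesis unfolding K_perp_def by (intro ominusI)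
qed

lemma inner_mult_K_perp:
  assumes "u \<in> H2"
  shows "(\<lambda>z. \<theta> z * u z) \<in> K_perp \<theta>"
  unfolding K_perp_def
proof (rule ominusI)
  show "(\<lambda>z. \<theta> z * u z) \<in> L2" by (rule inner_mult_L2[OF inner H2_L2[OF assms]])
  show "ip (\<lambda>z. \<theta> z * u z) k = 0" if "k \<in> K \<theta>" for k
    using K_orth[OF that assms] by (subst ip_commute) simp
qed

lemma inner_K_perp: "\<theta> \<in> K_perp \<theta>"
  using inner_mult_K_perp[OF H2_const[of 1]] by simp

lemma ip_inner_mult:
  assumes "f \<in> L2" "g \<in> L2"
  shows "ip (\<lambda>z. \<theta> z * f z) (\<lambda>z. \<theta> z * g z) = ip f g"
  unfolding ip_mult_left
proof (rule ip_cong_AE)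
  show "AE z in circle. cnj (\<theta> z) * (\<theta> z * g z) = g z"
    using inner_unimodular[OF inner] by eventually_elim (simp flip: mult.assoc)
qed (use assms in \<open>auto intro!: L2_Linf_mult[OF Linf_cnj[OF inner_Linf[OF inner]]] inner_mult_L2[OF inner]\<close>)

text \<open>
  \<open>f - Q_theta f\<close> equals \<open>P f - \<theta> P (cnj \<theta> f)\<close>. Against \<open>\<theta> u\<close> both terms have the inner
  product \<open>\<langle>f, \<theta> u\<rangle>\<close>, so the difference lies in the model space.
\<close>

lemma Q_theta_K_perp:
  assumes f: "f \<in> L2"
  shows "Q_theta \<theta> f \<in> K_perp \<theta>" "(\<lambda>z. f z - Q_theta \<theta> f z) \<in> K \<theta>"
proof -
  let ?g = "\<lambda>w. cnj (\<theta> w) * f w"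
  have g: "?g \<in> L2" by (rule L2_Linf_mult[OF Linf_cnj[OF inner_Linf[OF inner]] f])
  note Pf = P_H2[OF f] and Pg = P_H2[OF g]
  have Qf: "Q f \<in> K_perp \<theta>"
    using Pf(2) K_H2 by (auto simp: Q_def K_perp_def ominus_def)
  show "Q_theta \<theta> f \<in> K_perp \<theta>"
    unfolding Q_theta_def by (rule K_perp_add[OF Qf inner_mult_K_perp[OF Pg(1)]])
  have "(\<lambda>z. P f z - \<theta> z * P ?g z) \<in> K \<theta>"
    unfolding K_iff
  proof (intro conjI ballI)
    show "(\<lambda>z. P f z - \<theta> z * P ?g z) \<in> H2"
      by (rule H2_diff[OF Pf(1) inner_mult_H2[OF inner Pg(1)]])
    fix u assume u: "u \<in> H2"
    have "ip (\<lambda>z. P f z - \<theta> z * P ?g z) (\<lambda>z. \<theta> z * u z)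
        = ip (P f) (\<lambda>z. \<theta> z * u z) - ip (P ?g) u"
      using Pf(1) Pg(1) u by (simp add: ip_diff_left ip_inner_mult inner_mult_L2[OF inner] H2_L2)
    also have "ip (P f) (\<lambda>z. \<theta> z * u z) = ip f (\<lambda>z. \<theta> z * u z)"
      by (rule ip_P[OF f inner_mult_H2[OF inner u]])
    also have "ip (P ?g) u = ip f (\<lambda>z. \<theta> z * u z)"
      by (simp add: ip_P[OF g u] ip_mult_left)
    finally show "ip (\<lambda>z. P f z - \<theta> z * P ?g z) (\<lambda>z. \<theta> z * u z) = 0" by simp
  qed
  then show "(\<lambda>z. f z - Q_theta \<theta> f z) \<in> K \<theta>"
    by (simp add: Q_theta_def Q_def algebra_simps)
qed

text \<open>
  The values of \<open>Q_theta\<close> depend on a choice of representatives, but almost everywhere they are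
  forced by the orthogonal decomposition. All computations below go through this fact.
\<close>

lemma Q_theta_eqI:
  assumes f: "f \<in> L2" and q: "q \<in> K_perp \<theta>" and k: "k \<in> K \<theta>"
    and eq: "AE z in circle. f z = q z + k z"
  shows "AE z in circle. Q_theta \<theta> f z = q z"
proof -
  note Qf = Q_theta_K_perp[OF f]
  let ?d = "\<lambda>z. Q_theta \<theta> f z - q z" and ?e = "\<lambda>z. k z - (f z - Q_theta \<theta> f z)"
  have d: "?d \<in> K_perp \<theta>" by (rule K_perp_diff[OF Qf(1) q])
  have e: "?e \<in> K \<theta>" by (rule K_diff[OF k Qf(2)])
  have "AE z in circle. ?d z = ?e z" using eq by eventually_elim simp
  then have "ip ?d ?d = ip ?d ?e"
    using K_perp_L2[OF d] K_L2[OF e] by (intro ip_cong_AE) auto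
  also have "\<dots> = 0" by (rule ip_K_perp_K[OF d e])
  finally show ?thesis using AE_zero_of_ip_self[OF K_perp_L2[OF d]] by simp
qed

lemma ip_Q_theta:
  assumes f: "f \<in> L2" and q: "q \<in> K_perp \<theta>"
  shows "ip (Q_theta \<theta> f) q = ip f q"
  using ip_K_K_perp[OF q Q_theta_K_perp(2)[OF f]]
    ip_diff_left[OF f K_perp_L2[OF Q_theta_K_perp(1)[OF f]] K_perp_L2[OF q]] by simp

lemma Q_theta_diff_cmult:
  assumes f: "f \<in> L2" and g: "g \<in> L2" and e: "e \<in> L2"
    and eq: "AE z in circle. e z = f z - c * g z"
  shows "AE z in circle. Q_theta \<theta> e z = Q_theta \<theta> f z - c * Q_theta \<theta> g z"
proof (rule Q_theta_eqI[OF e])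
  show "(\<lambda>z. Q_theta \<theta> f z - c * Q_theta \<theta> g z) \<in> K_perp \<theta>"
    by (intro K_perp_diff K_perp_cmult Q_theta_K_perp f g)
  show "(\<lambda>z. (f z - Q_theta \<theta> f z) - c * (g z - Q_theta \<theta> g z)) \<in> K \<theta>"
    by (intro K_diff K_cmult Q_theta_K_perp f g)
  show "AE z in circle. e z = Q_theta \<theta> f z - c * Q_theta \<theta> g z
      + ((f z - Q_theta \<theta> f z) - c * (g z - Q_theta \<theta> g z))"
    using eq by eventually_elim (simp add: algebra_simps)
qed

section \<open>The compressed shift\<close>

text \<open>
  For \<open>u\<close> in the Hardy space, \<open>\<theta> u = u(0) \<theta> + z \<theta> B u\<close> with the backward shift \<open>B\<close>, which
  is how orthogonality to \<open>\<theta>\<close> times the Hardy space is tested below.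
\<close>

lemma ip_inner_mult_split:
  assumes f: "f \<in> L2" and u: "u \<in> H2"
  shows "ip f (\<lambda>z. \<theta> z * u z) = cnj (fourier_coeff u 0) * ip f \<theta>
    + ip (\<lambda>z. cnj z * f z) (\<lambda>z. \<theta> z * (cnj z * (u z - fourier_coeff u 0)))"
proof -
  let ?c = "fourier_coeff u 0"
  let ?B = "\<lambda>z. cnj z * (u z - ?c)"
  note B = H2_backward_shift[OF u]
  have "ip (\<lambda>z. cnj z * f z) (\<lambda>z. \<theta> z * ?B z) = ip f (\<lambda>z. \<theta> z * u z - ?c * \<theta> z)"
    unfolding ip_def
  proof (rule integral_circle_cong)
    fix z :: complex assume "cmod z = 1"
    then have "cnj z * z = 1" by (rule cnj_mult_circle)
    then show "cnj z * f z * cnj (\<theta> z * ?B z) = f z * cnj (\<theta> z * u z - ?c * \<theta> z)"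
      unfolding complex_cnj_mult complex_cnj_diff complex_cnj_cnj by algebra
  qed
  also have "\<dots> = ip f (\<lambda>z. \<theta> z * u z) - cnj ?c * ip f \<theta>"
    using f u by (simp add: ip_diff_right ip_cmult_right inner_mult_L2[OF inner] inner_L2[OF inner] L2_cmult H2_L2)
  finally show ?thesis by simp
qed

text \<open>
  The reproducing kernel of the model space at the origin, that is, the projection of the
  constant 1.
\<close>

lemma reproducing_kernel_K: "(\<lambda>z. 1 - cnj (fourier_coeff \<theta> 0) * \<theta> z) \<in> K \<theta>"
  unfolding K_iff
proof (intro conjI ballI)
  let ?t = "fourier_coeff \<theta> 0"
  show "(\<lambda>z. 1 - cnj ?t * \<theta> z) \<in> H2"
    by (intro H2_diff H2_const H2_cmult inner_H2[OF inner])
  fix u assume u: "u \<in> H2"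
  have "ip (\<lambda>z. 1) (\<lambda>z. \<theta> z * u z) = cnj (?t * fourier_coeff u 0)"
    using integral_inner_mult[OF inner u] by (simp add: ip_def flip: complex_cnj_mult)
  moreover have "ip \<theta> (\<lambda>z. \<theta> z * u z) = cnj (fourier_coeff u 0)"
    using ip_inner_mult[OF Linf_L2[OF Linf_const[of 1]] H2_L2[OF u]]
    by (simp add: ip_def fourier_coeff_0)
  ultimately show "ip (\<lambda>z. 1 - cnj ?t * \<theta> z) (\<lambda>z. \<theta> z * u z) = 0"
    using u by (simp add: ip_diff_left ip_cmult_left inner_mult_L2[OF inner] inner_L2[OF inner]
        L2_cmult H2_L2 Linf_L2 Linf_const)
qed

text \<open>
  The backward shift of \<open>\<theta>\<close>, that is, the projection of \<open>cnj z \<theta>\<close> to the model space; it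
  detects how far multiplication by \<open>z\<close> leads out of that space.
\<close>

lemma conjugate_kernel_K: "(\<lambda>z. cnj z * (\<theta> z - fourier_coeff \<theta> 0)) \<in> K \<theta>"
  unfolding K_iff
proof (intro conjI ballI)
  let ?t = "fourier_coeff \<theta> 0"
  show "(\<lambda>z. cnj z * (\<theta> z - ?t)) \<in> H2" by (rule H2_backward_shift[OF inner_H2[OF inner]])
  fix u assume u: "u \<in> H2"
  note zu = H2_shift[OF u]
  have "ip (\<lambda>z. cnj z * (\<theta> z - ?t)) (\<lambda>z. \<theta> z * u z)
      = ip (\<lambda>z. \<theta> z - ?t) (\<lambda>z. \<theta> z * (z * u z))"
    unfolding ip_mult_left by (simp add: mult_ac)
  also have "\<dots> = ip \<theta> (\<lambda>z. \<theta> z * (z * u z)) - ?t * ip (\<lambda>z. 1) (\<lambda>z. \<theta> z * (z * u z))"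
    using ip_diff_left[OF inner_L2[OF inner] Linf_L2[OF Linf_const[of ?t]] inner_mult_L2[OF inner H2_L2[OF zu]]]
      ip_cmult_left[of ?t "\<lambda>z. 1"] by simp
  also have "ip \<theta> (\<lambda>z. \<theta> z * (z * u z)) = ip (\<lambda>z. 1) (\<lambda>z. z * u z)"
    using ip_inner_mult[OF Linf_L2[OF Linf_const[of 1]] H2_L2[OF zu]] by simp
  also have "\<dots> = 0"
    using H2_moment[OF u, of 1] by (simp add: ip_def mult.commute flip: complex_cnj_mult)
  also have "ip (\<lambda>z. 1) (\<lambda>z. \<theta> z * (z * u z)) = 0"
    using H2_moment[OF inner_mult_H2[OF inner u], of 1]
    by (simp add: ip_def mult_ac flip: complex_cnj_mult)
  finally show "ip (\<lambda>z. cnj z * (\<theta> z - ?t)) (\<lambda>z. \<theta> z * u z) = 0" by simp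
qed

text \<open>
  The model space is invariant under the backward shift, because \<open>\<theta>\<close> times the Hardy space is
  invariant under multiplication by \<open>z\<close>.
\<close>

lemma K_backward_shift:
  assumes k: "k \<in> K \<theta>"
  shows "(\<lambda>z. cnj z * (k z - fourier_coeff k 0)) \<in> K \<theta>"
  unfolding K_iff
proof (intro conjI ballI)
  let ?c = "fourier_coeff k 0"
  show "(\<lambda>z. cnj z * (k z - ?c)) \<in> H2" by (rule H2_backward_shift[OF K_H2[OF k]])
  fix u assume u: "u \<in> H2"
  note zu = H2_shift[OF u]
  have "ip (\<lambda>z. cnj z * (k z - ?c)) (\<lambda>z. \<theta> z * u z)
      = ip (\<lambda>z. k z - ?c) (\<lambda>z. \<theta> z * (z * u z))"
    unfolding ip_mult_left by (simp add: mult_ac)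
  also have "\<dots> = ip k (\<lambda>z. \<theta> z * (z * u z)) - ?c * ip (\<lambda>z. 1) (\<lambda>z. \<theta> z * (z * u z))"
    using ip_diff_left[OF K_L2[OF k] Linf_L2[OF Linf_const[of ?c]] inner_mult_L2[OF inner H2_L2[OF zu]]]
      ip_cmult_left[of ?c "\<lambda>z. 1"] by simp
  also have "ip k (\<lambda>z. \<theta> z * (z * u z)) = 0" by (rule K_orth[OF k zu])
  also have "ip (\<lambda>z. 1) (\<lambda>z. \<theta> z * (z * u z)) = 0"
    using H2_moment[OF inner_mult_H2[OF inner u], of 1]
    by (simp add: ip_def mult_ac flip: complex_cnj_mult)
  finally show "ip (\<lambda>z. cnj z * (k z - ?c)) (\<lambda>z. \<theta> z * u z) = 0" by simp
qed

text \<open>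
  Multiplication by \<open>z\<close> maps the part of \<open>h\<close> in \<open>\<theta>\<close> times the Hardy space into the same space,
  and the part with negative frequencies into itself up to the constant
  \<open>c = \<langle>h, cnj z\<rangle>\<close>. So only the projection of \<open>c\<close> to the model space is lost. Orthogonality of the
  rest to \<open>k\<close> is tested by moving \<open>z\<close> to the other side, where it acts on \<open>k\<close> as the backward
  shift up to a multiple of \<open>cnj z\<close>.
\<close>

lemma compressed_shift_K_perp:
  assumes h: "h \<in> K_perp \<theta>"
  shows "AE z in circle. compressed_shift \<theta> h z
    = z * h z - ip h cnj * (1 - cnj (fourier_coeff \<theta> 0) * \<theta> z)"
  unfolding compressed_shift_def
proof (rule Q_theta_eqI)
  let ?t = "fourier_coeff \<theta> 0" and ?c = "ip h cnj"
  note hL = K_perp_L2[OF h]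
  show zh: "(\<lambda>z. z * h z) \<in> L2" by (rule L2_Linf_mult[OF Linf_id hL])
  show kk: "(\<lambda>z. ?c * (1 - cnj ?t * \<theta> z)) \<in> K \<theta>"
    by (rule K_cmult[OF reproducing_kernel_K])
  show "(\<lambda>z. z * h z - ?c * (1 - cnj ?t * \<theta> z)) \<in> K_perp \<theta>"
    unfolding K_perp_def
  proof (rule ominusI)
    show "(\<lambda>z. z * h z - ?c * (1 - cnj ?t * \<theta> z)) \<in> L2" by (rule L2_diff[OF zh K_L2[OF kk]])
    fix k assume k: "k \<in> K \<theta>"
    let ?k0 = "fourier_coeff k 0"
    have "0 = ip h (\<lambda>z. cnj z * (k z - ?k0))"
      by (rule ip_K_perp_K[OF h K_backward_shift[OF k], symmetric])
    also have "\<dots> = ip (\<lambda>z. z * h z) k - cnj ?k0 * ?c"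
    proof -
      have "ip h (\<lambda>z. cnj z * (k z - ?k0)) = ip h (\<lambda>z. cnj z * k z - ?k0 * cnj z)"
        by (simp add: algebra_simps)
      also have "\<dots> = ip h (\<lambda>z. cnj z * k z) - cnj ?k0 * ?c"
        using ip_diff_right[OF L2_Linf_mult[OF Linf_cnj[OF Linf_id] K_L2[OF k]] L2_cmult[OF K_perp_L2[OF cnj_K_perp]] hL]
        by (simp add: ip_cmult_right)
      finally show ?thesis by (simp add: ip_mult_left)
    qed
    finally have 1: "ip (\<lambda>z. z * h z) k = cnj ?k0 * ?c" by simp
    have 2: "ip (\<lambda>z. 1 - cnj ?t * \<theta> z) k = cnj ?k0"
    proof -
      have "ip (\<lambda>z. 1) k = cnj ?k0" by (simp add: ip_def fourier_coeff_0)
      moreover have "ip \<theta> k = 0" by (rule ip_K_perp_K[OF inner_K_perp k])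
      ultimately show ?thesis
        by (simp add: ip_diff_left ip_cmult_left inner_L2[OF inner] L2_cmult K_L2[OF k] Linf_L2 Linf_const)
    qed
    show "ip (\<lambda>z. z * h z - ?c * (1 - cnj ?t * \<theta> z)) k = 0"
      by (simp add: ip_diff_left[OF zh K_L2[OF kk] K_L2[OF k]] ip_cmult_left 1 2)
  qed
qed simp

text \<open>
  Multiplication by \<open>z\<close> leads out of the model space only in the direction of \<open>\<theta>\<close>: for a
  member \<open>k\<close> of it and \<open>u\<close> in the Hardy space,
  \<open>\<langle>z k, \<theta> u\<rangle> = cnj (u(0)) \<langle>z k, \<theta>\<rangle>\<close> by the splitting above.
\<close>

lemma shift_K_mod_theta:
  assumes k: "k \<in> K \<theta>"
  shows "(\<lambda>z. z * k z - ip k (\<lambda>z. cnj z * (\<theta> z - fourier_coeff \<theta> 0)) * \<theta> z) \<in> K \<theta>"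
  unfolding K_iff
proof (intro conjI ballI)
  let ?t = "fourier_coeff \<theta> 0"
  let ?d = "ip k (\<lambda>z. cnj z * (\<theta> z - ?t))"
  have zk: "(\<lambda>z. z * k z) \<in> H2" by (rule H2_shift[OF K_H2[OF k]])
  have d\<theta>: "(\<lambda>z. ?d * \<theta> z) \<in> H2" by (rule H2_cmult[OF inner_H2[OF inner]])
  show "(\<lambda>z. z * k z - ?d * \<theta> z) \<in> H2" by (rule H2_diff[OF zk d\<theta>])
  have d: "?d = ip (\<lambda>z. z * k z) \<theta>"
  proof -
    have "?d = ip k (\<lambda>z. cnj z * \<theta> z - ?t * cnj z)" by (simp add: algebra_simps)
    also have "\<dots> = ip k (\<lambda>z. cnj z * \<theta> z) - cnj ?t * ip k cnj"
      using ip_diff_right[OF L2_Linf_mult[OF Linf_cnj[OF Linf_id] inner_L2[OF inner]] L2_cmult[OF K_perp_L2[OF cnj_K_perp]] K_L2[OF k]]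
      by (simp add: ip_cmult_right)
    finally show ?thesis by (simp add: ip_cnj_H2[OF K_H2[OF k]] ip_mult_left)
  qed
  fix u assume u: "u \<in> H2"
  let ?B = "\<lambda>z. cnj z * (u z - fourier_coeff u 0)"
  have "ip (\<lambda>z. cnj z * (z * k z)) (\<lambda>z. \<theta> z * ?B z) = ip k (\<lambda>z. \<theta> z * ?B z)"
    unfolding ip_def
    by (rule integral_circle_cong) (simp add: cnj_mult_circle flip: mult.assoc)
  also have "\<dots> = 0" by (rule K_orth[OF k H2_backward_shift[OF u]])
  finally have 1: "ip (\<lambda>z. z * k z) (\<lambda>z. \<theta> z * u z) = cnj (fourier_coeff u 0) * ?d"
    unfolding ip_inner_mult_split[OF H2_L2[OF zk] u] d by simp
  have 2: "ip \<theta> (\<lambda>z. \<theta> z * u z) = cnj (fourier_coeff u 0)"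
    using ip_inner_mult[OF Linf_L2[OF Linf_const[of 1]] H2_L2[OF u]]
    by (simp add: ip_def fourier_coeff_0)
  show "ip (\<lambda>z. z * k z - ?d * \<theta> z) (\<lambda>z. \<theta> z * u z) = 0"
    unfolding ip_diff_left[OF H2_L2[OF zk] H2_L2[OF d\<theta>] inner_mult_L2[OF inner H2_L2[OF u]]]
      ip_cmult_left 1 2 by simp
qed

text \<open>
  The compressed shift intertwines multiplication by \<open>z\<close> with the projection up to a rank one
  term: the part \<open>k = g - Q_theta g\<close> removed before the shift would have contributed
  \<open>Q_theta (z k)\<close>, which is a multiple of \<open>\<theta>\<close>.
\<close>

lemma compressed_shift_Q_theta:
  assumes g: "g \<in> L2"
  shows "AE z in circle. compressed_shift \<theta> (Q_theta \<theta> g) z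
    = Q_theta \<theta> (\<lambda>w. w * g w) z - ip g (\<lambda>z. cnj z * (\<theta> z - fourier_coeff \<theta> 0)) * \<theta> z"
proof -
  let ?S = "\<lambda>z. cnj z * (\<theta> z - fourier_coeff \<theta> 0)"
  let ?q = "Q_theta \<theta> g"
  let ?k = "\<lambda>z. g z - ?q z"
  note q = Q_theta_K_perp(1)[OF g] and k = Q_theta_K_perp(2)[OF g]
  have d: "ip ?k ?S = ip g ?S"
    using ip_diff_left[OF g K_perp_L2[OF q] K_L2[OF conjugate_kernel_K]]
      ip_K_perp_K[OF q conjugate_kernel_K] by simp
  have zq: "(\<lambda>z. z * ?q z) \<in> L2" by (rule L2_Linf_mult[OF Linf_id K_perp_L2[OF q]])
  note U = Q_theta_K_perp[OF zq, folded compressed_shift_def]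
  have "AE z in circle. Q_theta \<theta> (\<lambda>w. w * g w) z
      = compressed_shift \<theta> ?q z + ip g ?S * \<theta> z"
  proof (rule Q_theta_eqI)
    show "(\<lambda>w. w * g w) \<in> L2" by (rule L2_Linf_mult[OF Linf_id g])
    show "(\<lambda>z. compressed_shift \<theta> ?q z + ip g ?S * \<theta> z) \<in> K_perp \<theta>"
      by (intro K_perp_add U K_perp_cmult inner_K_perp)
    show "(\<lambda>z. (z * ?q z - compressed_shift \<theta> ?q z) + (z * ?k z - ip ?k ?S * \<theta> z)) \<in> K \<theta>"
      by (intro K_add U shift_K_mod_theta k)
  qed (simp only: d, simp flip: distrib_left)
  then show ?thesis by eventually_elim simp
qed

end

section \<open>The rank two identity\<close>

text \<open>
  This number is, up to sign, what the error terms of the two applications of the compressed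
  shift contribute together to the coefficient of \<open>\<langle>h, cnj z\<rangle> \<theta>\<close>. The flip turns it into the
  integral of \<open>(1 - cnj \<theta>0 \<theta>) W\<close> for one function \<open>W\<close>, and the integrals of \<open>W\<close> and
  \<open>cnj \<theta>0 \<theta> W\<close> are the two terms on the right.
\<close>

lemma coefficient_of_theta:
  fixes \<theta>0 :: complex
  assumes \<theta>: "\<theta> \<in> Linf" and \<phi>: "\<phi> \<in> Linf" and \<theta>0: "\<theta>0 = fourier_coeff \<theta> 0"
  shows "ip (flip (\<lambda>z. \<phi> z * (1 - cnj \<theta>0 * \<theta> z))) (\<lambda>z. cnj z * (\<theta> z - \<theta>0))
    = cnj (ip (flip (alpha \<theta> (star \<phi>))) cnj) - delta \<theta> \<phi>"
proof -
  let ?W = "\<lambda>z. \<phi> z * (cnj z * cnj (\<theta> (cnj z) - \<theta>0))"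
  have f\<theta>: "(\<lambda>z. \<theta> (cnj z)) \<in> Linf" using Linf_flip[OF \<theta>] by (simp add: flip_def)
  have Winf: "?W \<in> Linf" by (intro Linf_intros \<phi> f\<theta>)
  note W = Linf_L2[OF Winf] and \<theta>W = Linf_L2[OF Linf_mult[OF \<theta> Winf]]
  have "ip (flip (\<lambda>z. \<phi> z * (1 - cnj \<theta>0 * \<theta> z))) (\<lambda>z. cnj z * (\<theta> z - \<theta>0))
      = ip (\<lambda>z. \<phi> z * (1 - cnj \<theta>0 * \<theta> z)) (flip (\<lambda>z. cnj z * (\<theta> z - \<theta>0)))"
    using \<phi> \<theta> by (intro ip_flip_left Linf_L2 Linf_intros)
  also have "\<dots> = (\<integral>z. ?W z - cnj \<theta>0 * (\<theta> z * ?W z) \<partial>circle)"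
    unfolding ip_def flip_def by (simp add: algebra_simps)
  also have "\<dots> = (\<integral>z. ?W z \<partial>circle) - cnj \<theta>0 * (\<integral>z. \<theta> z * ?W z \<partial>circle)"
    using L2_integrable[OF W] L2_integrable[OF \<theta>W] by (simp del: mult.assoc)
  also have "(\<integral>z. ?W z \<partial>circle) = cnj (ip (flip (alpha \<theta> (star \<phi>))) cnj)"
    unfolding ip_commute[symmetric, of "flip (alpha \<theta> (star \<phi>))"]
    by (simp add: ip_def flip_def alpha_def star_def \<theta>0 mult_ac)
  also have "cnj \<theta>0 * (\<integral>z. \<theta> z * ?W z \<partial>circle) = delta \<theta> \<phi>"
    unfolding delta_def Let_def by (simp add: ip_def star_def \<theta>0 mult_ac)
  finally show ?thesis .
qed

theorem theorem2p6:
  fixes \<theta> \<phi> :: "complex \<Rightarrow> complex" and \<theta>0 :: complex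
  assumes "inner_function \<theta>"
    and "\<phi> \<in> Linf"
    and "\<theta>0 = fourier_coeff \<theta> 0"
  shows "\<forall>h \<in> K_perp \<theta>. AE z in circle.
    dual_trunc_hankel \<theta> \<phi> h z
      - compressed_shift \<theta> (dual_trunc_hankel \<theta> \<phi> (compressed_shift \<theta> h)) z
    = rank_one \<theta>
        (\<lambda>w. Q_theta \<theta> (flip (alpha \<theta> (star \<phi>))) w
             - ip (Q_theta \<theta> (flip (alpha \<theta> (star \<phi>)))) cnj * cnj w) h z
      + rank_one
        (\<lambda>w. Q_theta \<theta> (flip (\<lambda>u. \<phi> u * cnj u * (1 - cnj \<theta>0 * \<theta> u))) w
             + delta \<theta> \<phi> * \<theta> w) cnj h z"
proof
  fix h assume h: "h \<in> K_perp \<theta>"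
  note inner = assms(1) and \<phi> = assms(2) and \<theta>0 = assms(3)
  note \<theta> = inner_Linf[OF inner]
  note hL = K_perp_L2[OF h]
  let ?c = "ip h cnj"
  let ?S = "\<lambda>z. cnj z * (\<theta> z - \<theta>0)"
  let ?A = "flip (alpha \<theta> (star \<phi>))"
  let ?Uh = "compressed_shift \<theta> h"
  let ?F = "flip (\<lambda>z. \<phi> z * h z)"
  let ?G = "flip (\<lambda>z. \<phi> z * (1 - cnj \<theta>0 * \<theta> z))"
  let ?g = "flip (\<lambda>z. \<phi> z * ?Uh z)"
  have zh: "(\<lambda>z. z * h z) \<in> L2" by (rule L2_Linf_mult[OF Linf_id hL])
  have UhL: "?Uh \<in> L2"
    unfolding compressed_shift_def by (rule K_perp_L2[OF Q_theta_K_perp(1)[OF inner zh]])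
  have F: "?F \<in> L2" by (rule L2_flip[OF L2_Linf_mult[OF \<phi> hL]])
  have G: "?G \<in> Linf" using \<phi> \<theta> by (intro Linf_flip Linf_intros)
  have g: "?g \<in> L2" by (rule L2_flip[OF L2_Linf_mult[OF \<phi> UhL]])
  have zF: "(\<lambda>z. cnj z * ?F z) \<in> L2" by (rule L2_Linf_mult[OF Linf_cnj[OF Linf_id] F])
  have S: "?S \<in> L2" using K_L2[OF inner conjugate_kernel_K[OF inner]] by (simp add: \<theta>0)
  have A: "?A \<in> L2"
  proof -
    have "star \<phi> \<in> Linf" using Linf_cnj[OF Linf_flip[OF \<phi>]] by (simp add: star_def flip_def)
    then show ?thesis unfolding alpha_def using \<theta> by (intro Linf_L2 Linf_flip Linf_intros)
  qed

  have "AE z in circle. ?Uh z = z * h z - ?c * (1 - cnj \<theta>0 * \<theta> z)"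
    unfolding \<theta>0 by (rule compressed_shift_K_perp[OF inner h])
  from AE_circle_cnj[OF this] have g_eq: "AE z in circle. ?g z = cnj z * ?F z - ?c * ?G z"
    by eventually_elim (simp only: flip_def complex_cnj_cnj, simp add: algebra_simps)
  \<comment> \<open>The flip exchanges multiplication by \<open>z\<close> with multiplication by its conjugate, so the outer
    shift cancels the inner one in the main term.\<close>
  have zg_eq: "AE z in circle. z * ?g z = ?F z - ?c * (z * ?G z)"
    using g_eq AE_circle_sphere
  proof eventually_elim
    case (elim z)
    have "z * (cnj z * ?F z) = ?F z"
      using cnj_mult_circle[OF elim(2)] by (metis mult.assoc mult.commute mult_1)
    moreover have "z * ?g z = z * (cnj z * ?F z) - ?c * (z * ?G z)"
      unfolding elim(1) by algebra
    ultimately show ?case by simp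
  qed

  have ip_g: "ip ?g ?S = ip (\<lambda>z. cnj z * ?F z) ?S - ?c * ip ?G ?S"
  proof -
    have "ip ?g ?S = ip (\<lambda>z. cnj z * ?F z - ?c * ?G z) ?S"
      by (intro ip_cong_AE g_eq g S L2_diff L2_cmult zF Linf_L2[OF G]) simp
    also have "\<dots> = ip (\<lambda>z. cnj z * ?F z) ?S - ?c * ip ?G ?S"
      by (simp add: ip_diff_left[OF zF L2_cmult[OF Linf_L2[OF G]] S] ip_cmult_left)
    finally show ?thesis .
  qed
  have ip_F: "ip (\<lambda>z. cnj z * ?F z) ?S = ip h (Q_theta \<theta> ?A)"
  proof -
    have "ip (\<lambda>z. cnj z * ?F z) ?S = ip ?F (\<lambda>z. \<theta> z - \<theta>0)"
      unfolding ip_def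
    proof (rule integral_circle_cong)
      fix z :: complex assume "cmod z = 1"
      then have "cnj z * z = 1" by (rule cnj_mult_circle)
      then show "cnj z * ?F z * cnj (?S z) = ?F z * cnj (\<theta> z - \<theta>0)"
        unfolding complex_cnj_mult complex_cnj_cnj by algebra
    qed
    also have "\<dots> = ip (\<lambda>z. \<phi> z * h z) (flip (\<lambda>z. \<theta> z - \<theta>0))"
      using \<theta> by (intro ip_flip_left L2_Linf_mult[OF \<phi> hL] Linf_L2 Linf_intros)
    also have "\<dots> = ip h ?A"
      by (simp add: ip_mult_left flip_def alpha_def star_def \<theta>0)
    also have "\<dots> = ip h (Q_theta \<theta> ?A)"
      using ip_Q_theta[OF inner A h] ip_commute[of h] by simp
    finally show ?thesis .
  qed
  have ip_A: "ip (Q_theta \<theta> ?A) cnj = ip ?A cnj"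
    by (rule ip_Q_theta[OF inner A cnj_K_perp[OF inner]])
  have ip_rhs: "ip h (\<lambda>w. Q_theta \<theta> ?A w - ip (Q_theta \<theta> ?A) cnj * cnj w)
      = ip h (Q_theta \<theta> ?A) - cnj (ip ?A cnj) * ?c"
    using ip_diff_right[OF K_perp_L2[OF Q_theta_K_perp(1)[OF inner A]]
        L2_cmult[OF K_perp_L2[OF cnj_K_perp[OF inner]]] hL]
    by (simp add: ip_cmult_right ip_A)

  have U: "AE z in circle. compressed_shift \<theta> (Q_theta \<theta> ?g) z
      = Q_theta \<theta> (\<lambda>w. w * ?g w) z - ip ?g ?S * \<theta> z"
    unfolding \<theta>0 by (rule compressed_shift_Q_theta[OF inner g[unfolded \<theta>0]])
  have zG: "(\<lambda>z. z * ?G z) = flip (\<lambda>u. \<phi> u * cnj u * (1 - cnj \<theta>0 * \<theta> u))"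
    by (simp add: flip_def mult_ac)
  have Qzg: "AE z in circle. Q_theta \<theta> (\<lambda>w. w * ?g w) z
      = Q_theta \<theta> ?F z - ?c * Q_theta \<theta> (\<lambda>z. z * ?G z) z"
    by (rule Q_theta_diff_cmult[OF inner F _ _ zg_eq])
       (intro L2_Linf_mult[OF Linf_id] g Linf_L2[OF G])+
  show "AE z in circle.
    dual_trunc_hankel \<theta> \<phi> h z
      - compressed_shift \<theta> (dual_trunc_hankel \<theta> \<phi> (compressed_shift \<theta> h)) z
    = rank_one \<theta>
        (\<lambda>w. Q_theta \<theta> (flip (alpha \<theta> (star \<phi>))) w
             - ip (Q_theta \<theta> (flip (alpha \<theta> (star \<phi>)))) cnj * cnj w) h z
      + rank_one
        (\<lambda>w. Q_theta \<theta> (flip (\<lambda>u. \<phi> u * cnj u * (1 - cnj \<theta>0 * \<theta> u))) w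
             + delta \<theta> \<phi> * \<theta> w) cnj h z"
    using U Qzg
  proof eventually_elim
    case (elim z)
    show ?case
      unfolding dual_trunc_hankel_def rank_one_def ip_rhs elim ip_g ip_F
        coefficient_of_theta[OF \<theta> \<phi> \<theta>0] zG
      by (simp add: algebra_simps)
  qed
qed

end
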